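(* Let $\mathcal{M}$ be a $\mathrm{II}_1$ factor, and equip its unitary group $U(\mathcal{M})$ with the norm topology. Then the universal covering group of $U(\mathcal{M})$ is not a perfect group.
   Context: $U(\mathcal{M})$ is the group of unitary elements of $\mathcal{M}$, with the subspace topology induced by the operator norm of $\mathcal{M}$. A covering group of a topological group $G$ is a topological group $\widetilde{G}$ together with a covering map $\rho:\widetilde{G}\to G$ that is a continuous group homomorphism; it is the universal covering group if $\widetilde{G}$ is simply connected (path-connected with trivial fundamental group). A group $G$ is perfect if it equals its derived subgroup $DG=\langle ghg^{-1}h^{-1}\mid g,h\in G\rangle$. *)

theory Defs
  imports "HOL-Analysis.Analysis" "HOL-Algebra.Generated_Groups"
begin

section \<open>Complex Hilbert spaces\<close>

text \<open>The norm and the real scalar multiplication inherited from \<^class>\<open>banach\<close> are tied to the complex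
  structure by \<open>scaleR_scaleC\<close> and \<open>cinner_self\<close>. The inner product is linear in its first
  argument. Positive definiteness follows from \<open>cinner_self\<close>.\<close>

class chilbert_space = banach +
  fixes scaleC :: "complex \<Rightarrow> 'a \<Rightarrow> 'a"
    and cinner :: "'a \<Rightarrow> 'a \<Rightarrow> complex"
  assumes scaleR_scaleC: "scaleR r x = scaleC (complex_of_real r) x"
    and scaleC_add_right: "scaleC a (x + y) = scaleC a x + scaleC a y"
    and scaleC_add_left: "scaleC (a + b) x = scaleC a x + scaleC b x"
    and scaleC_scaleC: "scaleC a (scaleC b x) = scaleC (a * b) x"
    and cinner_commute: "cinner x y = cnj (cinner y x)"
    and cinner_add_left: "cinner (x + y) z = cinner x z + cinner y z"
    and cinner_scaleC_left: "cinner (scaleC a x) y = a * cinner x y"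
    and cinner_self: "cinner x x = complex_of_real ((norm x)\<^sup>2)"
begin

lemma cinner_add_right: "cinner z (x + y) = cinner z x + cinner z y"
  by (metis cinner_add_left cinner_commute complex_cnj_add)

lemma cinner_scaleC_right: "cinner x (scaleC a y) = cnj a * cinner x y"
  by (metis cinner_scaleC_left cinner_commute complex_cnj_mult)

lemma cinner_scaleR_left: "cinner (scaleR r x) y = complex_of_real r * cinner x y"
  by (simp add: scaleR_scaleC cinner_scaleC_left)

lemma cinner_scaleR_right: "cinner x (scaleR r y) = complex_of_real r * cinner x y"
  by (simp add: scaleR_scaleC cinner_scaleC_right)

lemma norm_add_sq: "(norm (x + y))\<^sup>2 = (norm x)\<^sup>2 + (norm y)\<^sup>2 + 2 * Re (cinner x y)"
proof -
  have "complex_of_real ((norm (x + y))\<^sup>2)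
      = complex_of_real ((norm x)\<^sup>2) + complex_of_real ((norm y)\<^sup>2) + cinner x y + cinner y x"
    by (simp only: cinner_self[symmetric] cinner_add_left cinner_add_right) simp
  then have "Re (complex_of_real ((norm (x + y))\<^sup>2))
      = Re (complex_of_real ((norm x)\<^sup>2) + complex_of_real ((norm y)\<^sup>2) + cinner x y + cinner y x)"
    by (rule arg_cong)
  moreover have "Re (cinner y x) = Re (cinner x y)"
    by (subst cinner_commute) simp
  ultimately show ?thesis by simp
qed

lemma norm_scaleC: "norm (scaleC a x) = cmod a * norm x"
proof -
  have "complex_of_real ((norm (scaleC a x))\<^sup>2) = (a * cnj a) * complex_of_real ((norm x)\<^sup>2)"
    by (simp only: cinner_self[symmetric] cinner_scaleC_left cinner_scaleC_right) simp
  also have "\<dots> = complex_of_real ((cmod a * norm x)\<^sup>2)"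
    by (simp only: power_mult_distrib of_real_mult complex_norm_square[symmetric])
  finally have "(norm (scaleC a x))\<^sup>2 = (cmod a * norm x)\<^sup>2"
    by (simp only: of_real_eq_iff)
  then show ?thesis
    by (simp add: power2_eq_iff_nonneg)
qed

lemma Re_cinner_le: "Re (cinner x y) \<le> norm x * norm y"
proof -
  have "(norm (x + y))\<^sup>2 \<le> (norm x + norm y)\<^sup>2"
    by (simp add: norm_triangle_ineq power_mono)
  then show ?thesis
    by (simp add: norm_add_sq power2_sum)
qed

end

lemma bounded_linear_scaleC: "bounded_linear (scaleC a :: 'h::chilbert_space \<Rightarrow> 'h)"
  by (rule bounded_linear_intro[of _ "cmod a"])
     (simp_all add: scaleC_add_right scaleR_scaleC scaleC_scaleC norm_scaleC mult.commute)

section \<open>Bounded operators and adjoints\<close>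

text \<open>Elements of \<open>'h \<Rightarrow>\<^sub>L 'h\<close> are bounded and real-linear, with the operator norm.\<close>

definition bounded_operators :: "('h::chilbert_space \<Rightarrow>\<^sub>L 'h) set" where
  "bounded_operators = {A. \<forall>c x. blinfun_apply A (scaleC c x) = scaleC c (blinfun_apply A x)}"

definition scalar_op :: "complex \<Rightarrow> ('h::chilbert_space \<Rightarrow>\<^sub>L 'h)" where
  "scalar_op c = Blinfun (scaleC c)"

lemma scalar_op_apply [simp]: "blinfun_apply (scalar_op c) x = scaleC c x"
  by (simp add: scalar_op_def bounded_linear_Blinfun_apply bounded_linear_scaleC)

definition adj :: "('h::chilbert_space \<Rightarrow>\<^sub>L 'h) \<Rightarrow> ('h \<Rightarrow>\<^sub>L 'h)" where
  "adj A = (THE B. \<forall>x y. cinner (blinfun_apply A x) y = cinner x (blinfun_apply B y))"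

lemma riesz_Re:
  fixes f :: "'h::chilbert_space \<Rightarrow> real"
  assumes "bounded_linear f"
  shows "\<exists>y. \<forall>x. f x = Re (cinner x y)"
proof -
  interpret f: bounded_linear f by fact
  define g where "g x = (norm x)\<^sup>2 - 2 * f x" for x
  obtain K where K: "\<And>x. norm (f x) \<le> norm x * K"
    using f.bounded by blast
  have lower: "- K\<^sup>2 \<le> g x" for x
  proof -
    have "f x \<le> norm x * K" using K[of x] by simp
    moreover have "0 \<le> (norm x - K)\<^sup>2" by simp
    ultimately show ?thesis unfolding g_def by (simp add: power2_diff)
  qed
  define m where "m = Inf (range g)"
  have bdd: "bdd_below (range g)" using lower by (auto intro!: bdd_belowI)
  have m_le: "m \<le> g x" for x unfolding m_def using bdd by (simp add: cInf_lower)
  have "\<exists>x. g x < m + inverse (real (Suc n))" for n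
  proof -
    have "Inf (range g) < m + inverse (real (Suc n))" unfolding m_def by simp
    then show ?thesis using cInf_less_iff[of "range g"] bdd by auto
  qed
  then obtain X where X: "\<And>n. g (X n) < m + inverse (real (Suc n))" by metis
  have diff: "(norm (x - y))\<^sup>2 \<le> 2 * (g x - m) + 2 * (g y - m)" for x y
  proof -
    have "4 * m \<le> 4 * g ((1/2) *\<^sub>R (x + y))" using m_le by simp
    also have "\<dots> = (norm (x + y))\<^sup>2 - 4 * f x - 4 * f y"
      unfolding g_def by (simp add: f.scaleR f.add norm_scaleR power_divide del: scaleR_add_right)
        (simp add: field_simps)
    also have "(norm (x + y))\<^sup>2 = 2 * (norm x)\<^sup>2 + 2 * (norm y)\<^sup>2 - (norm (x - y))\<^sup>2"
      using norm_add_sq[of x y] norm_add_sq[of x "- y"] cinner_scaleR_right[of x "-1" y] by simp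
    finally show ?thesis unfolding g_def by simp
  qed
  have "Cauchy X"
  proof (rule metric_CauchyI)
    fix e :: real assume "e > 0"
    then have "e\<^sup>2 / 4 > 0" by simp
    then obtain N where N: "inverse (real (Suc N)) < e\<^sup>2 / 4" using reals_Archimedean by blast
    have small: "g (X n) - m < e\<^sup>2 / 4" if "n \<ge> N" for n
    proof -
      have "inverse (real (Suc n)) \<le> inverse (real (Suc N))" using that by (simp add: field_simps)
      then show ?thesis using X[of n] N by linarith
    qed
    have "dist (X i) (X j) < e" if "i \<ge> N" "j \<ge> N" for i j
    proof -
      have "(norm (X i - X j))\<^sup>2 < e\<^sup>2"
        using diff[of "X i" "X j"] small[OF that(1)] small[OF that(2)] by argo
      then show ?thesis
        using \<open>e > 0\<close> by (simp add: dist_norm power_less_imp_less_base)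
    qed
    then show "\<exists>M. \<forall>i\<ge>M. \<forall>j\<ge>M. dist (X i) (X j) < e" by blast
  qed
  then obtain y where y: "X \<longlonglongrightarrow> y" using Cauchy_convergent_iff convergent_def by blast
  have "(\<lambda>n. g (X n)) \<longlonglongrightarrow> g y"
    unfolding g_def by (intro tendsto_intros f.tendsto y)
  moreover have "(\<lambda>n. m + inverse (real (Suc n))) \<longlonglongrightarrow> m + 0"
    by (intro tendsto_intros LIMSEQ_inverse_real_of_nat)
  ultimately have gy: "g y \<le> m"
    using LIMSEQ_le[of "\<lambda>n. g (X n)" "g y" "\<lambda>n. m + inverse (real (Suc n))" "m + 0"] X
    by (auto intro: less_imp_le)
  have "f x = Re (cinner x y)" for x
  proof -
    define d where "d = Re (cinner y x) - f x"
    have quad: "0 \<le> 2 * t * d + t\<^sup>2 * (norm x)\<^sup>2" for t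
    proof -
      have "g y \<le> g (y + t *\<^sub>R x)" using gy m_le[of "y + t *\<^sub>R x"] by linarith
      also have "\<dots> = g y + 2 * t * d + t\<^sup>2 * (norm x)\<^sup>2"
        unfolding g_def d_def
        by (simp add: norm_add_sq cinner_scaleR_right f.add f.scaleR power_mult_distrib algebra_simps)
      finally show ?thesis by simp
    qed
    define s where "s = (norm x)\<^sup>2 + 1"
    have "s > 0" unfolding s_def by (simp add: add_nonneg_pos)
    have "0 \<le> 2 * (- d / s) * d + (- d / s)\<^sup>2 * (norm x)\<^sup>2" by (rule quad)
    also have "\<dots> \<le> 2 * (- d / s) * d + (- d / s)\<^sup>2 * s"
      unfolding s_def by (simp add: mult_left_mono)
    also have "\<dots> = - (d\<^sup>2 / s)"
      using \<open>s > 0\<close> by (simp add: field_simps power2_eq_square)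
    finally have "d\<^sup>2 / s \<le> 0" by simp
    then have "d = 0" using \<open>s > 0\<close> by (simp add: divide_le_0_iff)
    moreover have "Re (cinner y x) = Re (cinner x y)"
      by (subst cinner_commute) simp
    ultimately show ?thesis unfolding d_def by simp
  qed
  then show ?thesis by blast
qed

lemma cinner_eqI:
  fixes y z :: "'h::chilbert_space"
  assumes "\<And>x. Re (cinner x y) = Re (cinner x z)"
  shows "y = z"
proof -
  have "Re (cinner (y - z) (y + (-1) *\<^sub>R z)) = 0"
    unfolding cinner_add_right cinner_scaleR_right using assms[of "y - z"] by simp
  then show ?thesis by (simp add: cinner_self)
qed

lemma adj_ex:
  fixes A :: "'h::chilbert_space \<Rightarrow>\<^sub>L 'h"
  assumes "A \<in> bounded_operators"
  shows "\<exists>!B. \<forall>x y. cinner (blinfun_apply A x) y = cinner x (blinfun_apply B y)"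
proof -
  have "\<exists>z. \<forall>x. Re (cinner (A x) y) = Re (cinner x z)" for y
  proof (rule riesz_Re)
    show "bounded_linear (\<lambda>x. Re (cinner (A x) y))"
    proof (rule bounded_linear_intro[of _ "norm A * norm y"])
      fix x :: 'h
      have "\<bar>Re (cinner (A x) y)\<bar> \<le> norm (A x) * norm y"
        using Re_cinner_le[of "A x" y] Re_cinner_le[of "- A x" y]
          cinner_scaleR_left[of "-1" "A x" y] by simp
      also have "\<dots> \<le> (norm A * norm x) * norm y"
        by (intro mult_right_mono norm_blinfun) simp
      finally show "norm (Re (cinner (A x) y)) \<le> norm x * (norm A * norm y)"
        by (simp add: ac_simps)
    qed (simp_all add: blinfun.add_right blinfun.scaleR_right cinner_add_left cinner_scaleR_left)
  qed
  then obtain B where B: "\<And>x y. Re (cinner (A x) y) = Re (cinner x (B y))" by metis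
  have full: "cinner (A x) y = cinner x (B y)" for x y
  proof (rule complex_eqI)
    show "Re (cinner (A x) y) = Re (cinner x (B y))" by (rule B)
    show "Im (cinner (A x) y) = Im (cinner x (B y))"
      using B[of "scaleC \<i> x" y] assms
      by (simp add: bounded_operators_def cinner_scaleC_left)
  qed
  have "bounded_linear B"
  proof (rule bounded_linear_intro[of _ "norm A"])
    show "B (x + y) = B x + B y" for x y
      by (rule cinner_eqI) (simp add: cinner_add_right flip: B)
    show "B (r *\<^sub>R x) = r *\<^sub>R B x" for r x
      by (rule cinner_eqI) (simp add: cinner_scaleR_right flip: B)
    show "norm (B y) \<le> norm y * norm A" for y
    proof -
      have "norm (B y) * norm (B y) = Re (cinner (A (B y)) y)"
        by (simp add: B cinner_self power2_eq_square)
      also have "\<dots> \<le> norm (A (B y)) * norm y" by (rule Re_cinner_le)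
      also have "\<dots> \<le> (norm A * norm (B y)) * norm y"
        by (intro mult_right_mono norm_blinfun) simp
      finally have "norm (B y) * norm (B y) \<le> norm (B y) * (norm y * norm A)"
        by (simp add: ac_simps)
      then show ?thesis
        by (cases "norm (B y) = 0") (auto simp: mult_le_cancel_left)
    qed
  qed
  show ?thesis
  proof (rule ex1I[of _ "Blinfun B"])
    show "\<forall>x y. cinner (A x) y = cinner x (blinfun_apply (Blinfun B) y)"
      using full \<open>bounded_linear B\<close> by (simp add: bounded_linear_Blinfun_apply)
    fix C assume C: "\<forall>x y. cinner (A x) y = cinner x (blinfun_apply C y)"
    show "C = Blinfun B"
    proof (rule blinfun_eqI)
      show "blinfun_apply C y = blinfun_apply (Blinfun B) y" for y
        using C full \<open>bounded_linear B\<close>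
        by (intro cinner_eqI) (simp add: bounded_linear_Blinfun_apply)
    qed
  qed
qed

lemma cinner_adj:
  assumes "A \<in> bounded_operators"
  shows "cinner (blinfun_apply A x) y = cinner x (blinfun_apply (adj A) y)"
  unfolding adj_def using theI'[OF adj_ex[OF assms]] by blast

section \<open>Type \<open>II\<^sub>1\<close> factors\<close>

definition commutant :: "('h::chilbert_space \<Rightarrow>\<^sub>L 'h) set \<Rightarrow> ('h \<Rightarrow>\<^sub>L 'h) set" where
  "commutant S = {A \<in> bounded_operators. \<forall>B\<in>S. A o\<^sub>L B = B o\<^sub>L A}"

text \<open>The condition \<open>M = M''\<close> already makes \<open>M\<close> a unital subalgebra of the bounded operators.\<close>

definition von_neumann_algebra :: "('h::chilbert_space \<Rightarrow>\<^sub>L 'h) set \<Rightarrow> bool" where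
  "von_neumann_algebra M \<longleftrightarrow>
     M \<subseteq> bounded_operators \<and> (\<forall>A\<in>M. adj A \<in> M) \<and> commutant (commutant M) = M"

definition factor :: "('h::chilbert_space \<Rightarrow>\<^sub>L 'h) set \<Rightarrow> bool" where
  "factor M \<longleftrightarrow> von_neumann_algebra M \<and> M \<inter> commutant M = range scalar_op"

definition positive_op :: "('h::chilbert_space \<Rightarrow>\<^sub>L 'h) \<Rightarrow> bool" where
  "positive_op A \<longleftrightarrow>
     A \<in> bounded_operators \<and> (\<forall>x. cinner (blinfun_apply A x) x \<in> \<real>\<^sub>\<ge>\<^sub>0)"

definition op_le :: "('h::chilbert_space \<Rightarrow>\<^sub>L 'h) \<Rightarrow> ('h \<Rightarrow>\<^sub>L 'h) \<Rightarrow> bool" where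
  "op_le A B \<longleftrightarrow> positive_op (B - A)"

definition tracial_state ::
    "('h::chilbert_space \<Rightarrow>\<^sub>L 'h) set \<Rightarrow> (('h \<Rightarrow>\<^sub>L 'h) \<Rightarrow> complex) \<Rightarrow> bool" where
  "tracial_state M \<tau> \<longleftrightarrow>
     (\<forall>A\<in>M. \<forall>B\<in>M. \<tau> (A + B) = \<tau> A + \<tau> B) \<and>
     (\<forall>c. \<forall>A\<in>M. \<tau> (scalar_op c o\<^sub>L A) = c * \<tau> A) \<and>
     (\<forall>A\<in>M. positive_op A \<longrightarrow> \<tau> A \<in> \<real>\<^sub>\<ge>\<^sub>0) \<and>
     \<tau> id_blinfun = 1 \<and>
     (\<forall>A\<in>M. \<forall>B\<in>M. \<tau> (A o\<^sub>L B) = \<tau> (B o\<^sub>L A))"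

definition faithful_state ::
    "('h::chilbert_space \<Rightarrow>\<^sub>L 'h) set \<Rightarrow> (('h \<Rightarrow>\<^sub>L 'h) \<Rightarrow> complex) \<Rightarrow> bool" where
  "faithful_state M \<tau> \<longleftrightarrow> (\<forall>A\<in>M. positive_op A \<and> \<tau> A = 0 \<longrightarrow> A = 0)"

text \<open>Normality: the state preserves suprema of bounded upward directed sets of positive elements.
  Boundedness of \<open>D\<close> is part of the existence of its supremum \<open>S\<close>.\<close>

definition normal_state ::
    "('h::chilbert_space \<Rightarrow>\<^sub>L 'h) set \<Rightarrow> (('h \<Rightarrow>\<^sub>L 'h) \<Rightarrow> complex) \<Rightarrow> bool" where
  "normal_state M \<tau> \<longleftrightarrow>
     (\<forall>D S. D \<noteq> {} \<and> D \<subseteq> {A\<in>M. positive_op A} \<and>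
            (\<forall>A\<in>D. \<forall>B\<in>D. \<exists>C\<in>D. op_le A C \<and> op_le B C) \<and>
            S \<in> M \<and> (\<forall>A\<in>D. op_le A S) \<and>
            (\<forall>S'\<in>M. (\<forall>A\<in>D. op_le A S') \<longrightarrow> op_le S S')
        \<longrightarrow> \<tau> S = complex_of_real (SUP A\<in>D. Re (\<tau> A)))"

text \<open>A factor is of type \<open>II\<^sub>1\<close> if it is infinite-dimensional and carries a faithful normal tracial
  state. Real span suffices here, because a complex vector space has finite complex dimension
  if and only if it has finite real dimension.\<close>

definition II1_factor :: "('h::chilbert_space \<Rightarrow>\<^sub>L 'h) set \<Rightarrow> bool" where
  "II1_factor M \<longleftrightarrow>
     factor M \<and>
     \<not> (\<exists>F. finite F \<and> M \<subseteq> span F) \<and>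
     (\<exists>\<tau>. tracial_state M \<tau> \<and> faithful_state M \<tau> \<and> normal_state M \<tau>)"

section \<open>The unitary group\<close>

definition unitary_group :: "('h::chilbert_space \<Rightarrow>\<^sub>L 'h) set \<Rightarrow> ('h \<Rightarrow>\<^sub>L 'h) monoid" where
  "unitary_group M =
     \<lparr>carrier = {u\<in>M. adj u o\<^sub>L u = id_blinfun \<and> u o\<^sub>L adj u = id_blinfun},
      mult = (o\<^sub>L), one = id_blinfun\<rparr>"

section \<open>Topological groups, covering groups, perfect groups\<close>

text \<open>The topology on a group is the subspace topology of its carrier in the ambient type. For
  the unitary group this is the operator norm topology.\<close>

definition topological_group :: "('g::topological_space, 'b) monoid_scheme \<Rightarrow> bool" where
  "topological_group G \<longleftrightarrow>
     group G \<and>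
     continuous_on (carrier G \<times> carrier G) (\<lambda>(x, y). x \<otimes>\<^bsub>G\<^esub> y) \<and>
     continuous_on (carrier G) (\<lambda>x. inv\<^bsub>G\<^esub> x)"

definition covering_group ::
    "('g::topological_space, 'b) monoid_scheme \<Rightarrow> ('g \<Rightarrow> 'k) \<Rightarrow>
     ('k::topological_space, 'c) monoid_scheme \<Rightarrow> bool" where
  "covering_group G' \<rho> G \<longleftrightarrow>
     topological_group G' \<and> topological_group G \<and>
     covering_space (carrier G') \<rho> (carrier G) \<and> \<rho> \<in> hom G' G"

text \<open>The library's \<^const>\<open>simply_connected\<close> asks that any two loops are freely homotopic, which
  includes path-connectedness (take constant loops).\<close>

definition universal_covering_group ::
    "('g::topological_space, 'b) monoid_scheme \<Rightarrow> ('g \<Rightarrow> 'k) \<Rightarrow>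
     ('k::topological_space, 'c) monoid_scheme \<Rightarrow> bool" where
  "universal_covering_group G' \<rho> G \<longleftrightarrow>
     covering_group G' \<rho> G \<and> simply_connected (carrier G')"

definition perfect_group :: "('g, 'b) monoid_scheme \<Rightarrow> bool" where
  "perfect_group G \<longleftrightarrow> derived G (carrier G) = carrier G"

end

theory Submission
  imports Defs
begin

text \<open>Let \<open>\<tau>\<close> be the trace. Near the identity, \<open>T (log (u v)) = T (log u) + T (log v)\<close> for
  \<open>T = Im \<circ> \<tau>\<close>, so \<open>c(u, v) = T (log (u\<^sup>-\<^sup>1 v))\<close> is a left-invariant cocycle defined for nearby unitaries
  (an infinitesimal form of the Fuglede--Kadison / de la Harpe--Skandalis determinant). On the covering
  group, sum \<open>c\<close> over fine dyadic subdivisions of a path starting at the unit. The sums are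
  eventually constant, and by simple connectedness they depend only on the endpoint of the path, which
  yields an additive real function on the group. It equals \<open>t\<close> on the lift of \<open>exp (i t)\<close> for
  small \<open>t\<close>, whereas additive functions vanish on commutators.\<close>

section \<open>Integrating a local cocycle over a simply connected group\<close>

text \<open>The group carries only a topology, so nearness is measured in the metric space reached
  by \<open>\<rho>\<close>. Additivity is asked for two consecutive short steps; the outer points
  \<open>x\<close> and \<open>z\<close> may be further apart.\<close>

locale group_cocycle =
  fixes G :: "('g::topological_space, 'b) monoid_scheme" (structure)
    and \<rho> :: "'g \<Rightarrow> 'k::metric_space" and c :: "'g \<Rightarrow> 'g \<Rightarrow> real" and \<delta> :: real
  assumes topological_group: "topological_group G"
    and simply_connected: "simply_connected (carrier G)"
    and continuous: "continuous_on (carrier G) \<rho>"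
    and delta_pos: "\<delta> > 0"
    and cocycle: "\<lbrakk>x \<in> carrier G; y \<in> carrier G; z \<in> carrier G;
          dist (\<rho> x) (\<rho> y) < \<delta>; dist (\<rho> y) (\<rho> z) < \<delta>\<rbrakk> \<Longrightarrow> c x z = c x y + c y z"
    and left_invariant: "\<lbrakk>g \<in> carrier G; x \<in> carrier G; y \<in> carrier G\<rbrakk>
          \<Longrightarrow> c (g \<otimes> x) (g \<otimes> y) = c x y"
begin

section \<open>Dyadic sums of the cocycle along paths\<close>

sublocale group G
  using topological_group by (simp add: topological_group_def)

text \<open>A Riemann sum for the integral of the cocycle along \<open>p\<close>. Dyadic meshes
  refine one another, and their midpoint is the junction of \<open>+++\<close>.\<close>

definition dyadic_sum :: "nat \<Rightarrow> (real \<Rightarrow> 'g) \<Rightarrow> real" where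
  "dyadic_sum n p = (\<Sum>i<2^n. c (p (real i / 2^n)) (p (real (Suc i) / 2^n)))"

text \<open>A relation instead of a function, because existence of a value and its independence of
  the path are separate matters.\<close>

definition path_value :: "'g \<Rightarrow> real \<Rightarrow> bool" where
  "path_value g r \<longleftrightarrow> (\<exists>p. path p \<and> path_image p \<subseteq> carrier G \<and> pathstart p = \<one> \<and> pathfinish p = g
     \<and> (\<forall>\<^sub>F n in sequentially. dyadic_sum n p = r))"

lemma cocycle_self: "x \<in> carrier G \<Longrightarrow> c x x = 0"
  using cocycle[of x x x] delta_pos by simp

lemma dyadic_mesh:
  assumes "i < 2^n" shows "real i / 2^n \<in> {0..1}" "real (Suc i) / 2^n \<in> {0..1}"
proof -
  have "real (Suc i) \<le> real (2^n)" using assms by (metis Suc_leI of_nat_le_iff)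
  then have "real i + 1 \<le> 2^n" by simp
  then show "real i / 2^n \<in> {0..1}" "real (Suc i) / 2^n \<in> {0..1}" using assms by (auto simp: divide_le_eq)
qed

text \<open>\<open>\<rho>\<close> composed with a path is uniformly continuous on the compact unit
  interval.\<close>

lemma path_close:
  assumes "path p" "path_image p \<subseteq> carrier G" "e > 0"
  shows "\<forall>\<^sub>F n in sequentially. \<forall>s\<in>{0..1}. \<forall>t\<in>{0..1}. \<bar>s - t\<bar> \<le> 1 / 2^n \<longrightarrow> dist (\<rho> (p s)) (\<rho> (p t)) < e"
proof -
  have "continuous_on {0..1} (\<lambda>t. \<rho> (p t))"
    using assms continuous by (auto intro!: continuous_on_compose2[OF continuous, of _ p] simp: path_def path_image_def)
  then have "uniformly_continuous_on {0..1} (\<lambda>t. \<rho> (p t))"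
    by (intro compact_uniformly_continuous) auto
  then obtain d where d: "d > 0" "\<And>s t. \<lbrakk>s \<in> {0..1}; t \<in> {0..1}; dist s t < d\<rbrakk> \<Longrightarrow> dist (\<rho> (p s)) (\<rho> (p t)) < e"
    using \<open>e > 0\<close> unfolding uniformly_continuous_on_def by metis
  have "(\<lambda>n. (1/2::real)^n) \<longlonglongrightarrow> 0" by (intro LIMSEQ_power_zero) auto
  then have "\<forall>\<^sub>F n in sequentially. (1/2::real)^n < d"
    using order_tendstoD(2) d(1) by blast
  then show ?thesis
    by eventually_elim (use d(2) in \<open>auto simp: dist_real_def power_divide\<close>)
qed

text \<open>Passing from level \<open>n\<close> to \<open>Suc n\<close> inserts a midpoint in every
  interval. Once the mesh is fine, the cocycle identity splits each term exactly, so the sum no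
  longer changes.\<close>

lemma dyadic_sum_eventually_const:
  assumes "path p" "path_image p \<subseteq> carrier G"
  obtains r where "\<forall>\<^sub>F n in sequentially. dyadic_sum n p = r"
proof -
  obtain N where N: "\<And>n s t. \<lbrakk>n \<ge> N; s \<in> {0..1}; t \<in> {0..1}; \<bar>s - t\<bar> \<le> 1 / 2^n\<rbrakk>
      \<Longrightarrow> dist (\<rho> (p s)) (\<rho> (p t)) < \<delta>"
    using path_close[OF assms delta_pos] unfolding eventually_sequentially by metis
  have inG: "p t \<in> carrier G" if "t \<in> {0..1}" for t
    using assms(2) that by (auto simp: path_image_def)
  have step: "dyadic_sum (Suc n) p = dyadic_sum n p" if "n \<ge> N" for n
  proof -
    have split: "c (p (real i / 2^n)) (p (real (Suc i) / 2^n))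
        = c (p (real (2*i) / 2^Suc n)) (p (real (2*i+1) / 2^Suc n))
        + c (p (real (2*i+1) / 2^Suc n)) (p (real (2*i+2) / 2^Suc n))" if i: "i < 2^n" for i
    proof -
      have eq: "real i / 2^n = real (2*i) / 2^Suc n" "real (Suc i) / 2^n = real (2*i+2) / 2^Suc n"
        by (auto simp: field_simps)
      have "2*i+1 < 2^Suc n" using i by simp
      from dyadic_mesh(1)[OF this] have m: "real (2*i+1) / 2^Suc n \<in> {0..1}" .
      show ?thesis
        unfolding eq using m dyadic_mesh[OF i] \<open>n \<ge> N\<close> unfolding eq
        by (intro cocycle inG N[of n]) (auto simp: field_simps abs_if)
    qed
    \<comment> \<open>The intervals of the finer mesh are grouped in consecutive pairs, each pair
      subdividing one coarse interval.\<close>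
    have "dyadic_sum (Suc n) p = (\<Sum>i<2^n * 2. c (p (real i / 2^Suc n)) (p (real (Suc i) / 2^Suc n)))"
      by (simp add: dyadic_sum_def mult.commute)
    also have "\<dots> = (\<Sum>i<2^n. \<Sum>j\<in>{i*2..<i*2+2}. c (p (real j / 2^Suc n)) (p (real (Suc j) / 2^Suc n)))"
      by (rule sum.nat_group[symmetric])
    also have "\<dots> = dyadic_sum n p"
      unfolding dyadic_sum_def
      by (intro sum.cong refl) (subst split, simp_all add: numeral_2_eq_2 mult.commute)
    finally show ?thesis .
  qed
  have "dyadic_sum n p = dyadic_sum N p" if "n \<ge> N" for n
    using that by (induction n rule: dec_induct) (auto simp: step)
  then show ?thesis
    using that unfolding eventually_sequentially by blast
qed

text \<open>Each half of the join runs at double speed, so the mesh of level \<open>Suc n\<close>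
  restricts to the meshes of level \<open>n\<close> of \<open>p\<close> and
  \<open>q\<close>.\<close>

lemma dyadic_sum_join:
  assumes "pathfinish p = pathstart q"
  shows "dyadic_sum (Suc n) (p +++ q) = dyadic_sum n p + dyadic_sum n q"
proof -
  let ?f = "\<lambda>i. c ((p +++ q) (real i / 2^Suc n)) ((p +++ q) (real (Suc i) / 2^Suc n))"
  have left: "(p +++ q) (real i / 2^Suc n) = p (real i / 2^n)" if "i \<le> 2^n" for i
  proof -
    have "real i \<le> real (2^n)" using that by (simp only: of_nat_le_iff)
    then show ?thesis by (simp add: joinpaths_def field_simps)
  qed
  \<comment> \<open>At the junction \<open>1/2\<close>, \<open>+++\<close> still follows the first
    path, so the index \<open>0\<close> relies on the matching endpoints.\<close>
  have right: "(p +++ q) (real (i + 2^n) / 2^Suc n) = q (real i / 2^n)" for i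
  proof (cases "i = 0")
    case True
    then show ?thesis using left[of "2^n"] assms by (simp add: pathfinish_def pathstart_def)
  next
    case False
    then show ?thesis by (simp add: joinpaths_def field_simps)
  qed
  have "{..<2^Suc n} = {..<2^n + 2^n :: nat}" by simp
  then have "dyadic_sum (Suc n) (p +++ q) = sum ?f {..<2^n + 2^n}"
    by (simp only: dyadic_sum_def)
  also have "\<dots> = sum ?f {..<2^n} + sum ?f {2^n..<2^n + 2^n}"
    using sum.atLeastLessThan_concat[of 0 "2^n" "2^n + 2^n" ?f] by (simp only: lessThan_atLeast0)
  also have "sum ?f {2^n..<2^n + 2^n} = (\<Sum>i<2^n. ?f (i + 2^n))"
    using sum.shift_bounds_nat_ivl[of ?f 0 "2^n" "2^n"] by (simp add: lessThan_atLeast0)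
  also have "\<dots> = dyadic_sum n q"
    unfolding dyadic_sum_def by (simp only: right flip: add_Suc)
  also have "sum ?f {..<2^n} = dyadic_sum n p"
    unfolding dyadic_sum_def by (intro sum.cong refl) (simp add: left del: power_Suc of_nat_Suc)
  finally show ?thesis .
qed

text \<open>A path to \<open>g\<close> is continued by the \<open>g\<close>-translate of a path to
  \<open>h\<close>; by left invariance the translate has the same dyadic sums.\<close>

lemma path_value_mult:
  assumes "path_value g r" "path_value h s"
  shows "path_value (g \<otimes> h) (r + s)"
proof -
  obtain p where p: "path p" "path_image p \<subseteq> carrier G" "pathstart p = \<one>" "pathfinish p = g"
      "\<forall>\<^sub>F n in sequentially. dyadic_sum n p = r"
    using assms(1) path_value_def by auto
  obtain q where q: "path q" "path_image q \<subseteq> carrier G" "pathstart q = \<one>" "pathfinish q = h"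
      "\<forall>\<^sub>F n in sequentially. dyadic_sum n q = s"
    using assms(2) path_value_def by auto
  have g: "g \<in> carrier G" using p pathfinish_in_path_image by blast
  have qG: "q t \<in> carrier G" if "t \<in> {0..1}" for t
    using q(2) that by (auto simp: path_image_def)
  define q' where "q' t = g \<otimes> q t" for t
  have "continuous_on (carrier G \<times> carrier G) (\<lambda>(x, y). x \<otimes> y)"
    using topological_group by (simp add: topological_group_def)
  moreover have "continuous_on {0..1} (\<lambda>t. (g, q t))"
    using q(1) by (intro continuous_intros) (auto simp: path_def)
  ultimately have q'1: "path q'"
    using continuous_on_compose2[of "carrier G \<times> carrier G" "\<lambda>(x, y). x \<otimes> y" "{0..1}" "\<lambda>t. (g, q t)"] g qG
    by (force simp: path_def q'_def[abs_def])
  have q'2: "path_image q' \<subseteq> carrier G" using g qG by (auto simp: path_image_def q'_def)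
  have q'3: "pathstart q' = g" "pathfinish q' = g \<otimes> h"
    using q(3,4) g by (auto simp: q'_def pathstart_def pathfinish_def)
  have q'4: "dyadic_sum n q' = dyadic_sum n q" for n
    unfolding dyadic_sum_def q'_def
    by (intro sum.cong refl left_invariant g qG dyadic_mesh) auto
  have "\<forall>\<^sub>F n in sequentially. dyadic_sum (Suc n) (p +++ q') = r + s"
    using p(5) q(5) by eventually_elim (simp add: dyadic_sum_join p(4) q'3 q'4)
  then have "\<forall>\<^sub>F n in sequentially. dyadic_sum n (p +++ q') = r + s"
    using eventually_sequentially_Suc[of "\<lambda>n. dyadic_sum n (p +++ q') = r + s"] by blast
  then show ?thesis
    unfolding path_value_def using p q'1 q'2 q'3 by (intro exI[of _ "p +++ q'"]) (auto simp: path_image_join)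
qed

text \<open>In a free homotopy between the constant loops at \<open>\<one>\<close> and
  \<open>g\<close>, the base point traces a path from \<open>\<one>\<close> to
  \<open>g\<close>.\<close>

lemma path_value_exists:
  assumes "g \<in> carrier G"
  obtains r where "path_value g r"
proof -
  have "homotopic_loops (carrier G) (\<lambda>t. \<one>) (\<lambda>t. g)"
    using assms by (intro simply_connected[unfolded simply_connected_def, rule_format])
      (auto simp: path_def path_image_def pathstart_def pathfinish_def)
  then obtain h where h: "continuous_on ({0..1::real} \<times> {0..1::real}) h"
      "h \<in> ({0..1} \<times> {0..1}) \<rightarrow> carrier G" "h (0,0) = \<one>" "h (1,0) = g"
    unfolding homotopic_loops by auto
  define p where "p t = h (t, 0)" for t
  have "path p"
    unfolding path_def p_def by (intro continuous_on_compose2[OF h(1)] continuous_intros) auto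
  moreover have "path_image p \<subseteq> carrier G"
    using h(2) by (auto simp: path_image_def p_def)
  ultimately show ?thesis
    using dyadic_sum_eventually_const[of p] that h(3,4)
    by (metis p_def path_value_def pathfinish_def pathstart_def)
qed

text \<open>A discrete Stokes argument. A contracting homotopy is sampled on a square grid so fine
  that neighbouring points are close; moving to the next row does not change the row sum, and the
  last row is constant.\<close>

lemma dyadic_sum_loop:
  assumes "path p" "path_image p \<subseteq> carrier G" "pathstart p = \<one>" "pathfinish p = \<one>"
  shows "\<forall>\<^sub>F n in sequentially. dyadic_sum n p = 0"
proof -
  have "homotopic_loops (carrier G) p (\<lambda>t. \<one>)"
    using assms by (intro simply_connected[unfolded simply_connected_def, rule_format])
      (auto simp: path_def path_image_def pathstart_def pathfinish_def)
  then obtain h where h: "continuous_on ({0..1::real} \<times> {0..1::real}) h"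
      "h \<in> ({0..1} \<times> {0..1}) \<rightarrow> carrier G" "\<And>t. t \<in> {0..1} \<Longrightarrow> h (0,t) = p t"
      "\<And>t. t \<in> {0..1} \<Longrightarrow> h (1,t) = \<one>" "\<And>s. s \<in> {0..1} \<Longrightarrow> h (s,1) = h (s,0)"
    unfolding homotopic_loops by (auto simp: pathstart_def pathfinish_def)
  have "continuous_on ({0..1} \<times> {0..1}) (\<lambda>x. \<rho> (h x))"
    using h(2) by (intro continuous_on_compose2[OF continuous h(1)]) auto
  then have "uniformly_continuous_on ({0..1} \<times> {0..1}) (\<lambda>x. \<rho> (h x))"
    by (intro compact_uniformly_continuous compact_Times) auto
  then obtain d where d: "d > 0" "\<And>x y. \<lbrakk>x \<in> {0..1} \<times> {0..1}; y \<in> {0..1} \<times> {0..1}; dist x y < d\<rbrakk>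
      \<Longrightarrow> dist (\<rho> (h x)) (\<rho> (h y)) < \<delta>"
    using delta_pos unfolding uniformly_continuous_on_def by metis
  have "(\<lambda>n. (1/2::real)^n) \<longlonglongrightarrow> 0" by (intro LIMSEQ_power_zero) auto
  then have "\<forall>\<^sub>F n in sequentially. (1/2::real)^n < d"
    using order_tendstoD(2) d(1) by blast
  then show ?thesis
  proof eventually_elim
    case (elim n)
    define H where "H i j = h (real i / 2^n, real j / 2^n)" for i j :: nat
    have mesh: "real i / 2^n \<in> {0..1}" if "i \<le> 2^n" for i
    proof -
      have "real i \<le> real (2^n)" using that by (simp only: of_nat_le_iff)
      then show ?thesis by (simp add: field_simps)
    qed
    have HG: "H i j \<in> carrier G" if "i \<le> 2^n" "j \<le> 2^n" for i j
      using h(2) mesh[OF that(1)] mesh[OF that(2)] unfolding H_def by blast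
    have small: "dist (real (Suc i) / 2^n) (real i / 2^n) < d" "dist (real i / 2^n) (real (Suc i) / 2^n) < d" for i
      using elim by (simp_all add: dist_real_def power_divide field_simps)
    have close: "dist (\<rho> (H i j)) (\<rho> (H (Suc i) j)) < \<delta>" "dist (\<rho> (H j i)) (\<rho> (H j (Suc i))) < \<delta>"
      if "i < 2^n" "j \<le> 2^n" for i j
      unfolding H_def using mesh[of i] mesh[of "Suc i"] mesh[of j] that small[of i]
      by (auto intro!: d(2) simp: dist_Pair_Pair simp del: of_nat_Suc)
    define row where "row i = (\<Sum>j<2^n. c (H i j) (H i (Suc j)))" for i
    have "row (Suc i) = row i" if i: "i < 2^n" for i
    proof -
      \<comment> \<open>The diagonal of a grid cell is decomposed along either pair of adjacent
        edges.\<close>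
      have sq: "c (H i j) (H i (Suc j)) - c (H (Suc i) j) (H (Suc i) (Suc j))
          = c (H i j) (H (Suc i) j) - c (H i (Suc j)) (H (Suc i) (Suc j))" if j: "j < 2^n" for j
      proof -
        have "c (H i j) (H (Suc i) (Suc j)) = c (H i j) (H i (Suc j)) + c (H i (Suc j)) (H (Suc i) (Suc j))"
          using i j by (intro cocycle HG close) auto
        moreover have "c (H i j) (H (Suc i) (Suc j)) = c (H i j) (H (Suc i) j) + c (H (Suc i) j) (H (Suc i) (Suc j))"
          using i j by (intro cocycle HG close) auto
        ultimately show ?thesis by simp
      qed
      have "row i - row (Suc i) = (\<Sum>j<2^n. c (H i j) (H (Suc i) j) - c (H i (Suc j)) (H (Suc i) (Suc j)))"
        unfolding row_def sum_subtractf[symmetric] by (intro sum.cong refl sq) auto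
      also have "\<dots> = c (H i 0) (H (Suc i) 0) - c (H i (2^n)) (H (Suc i) (2^n))"
        by (rule sum_lessThan_telescope')
      \<comment> \<open>The homotopy is free, so the base point may move, but every intermediate
        curve is closed and the two outer edges coincide.\<close>
      also have "\<dots> = 0"
        using h(5) mesh[of i] mesh[of "Suc i"] i by (simp add: H_def del: of_nat_Suc)
      finally show ?thesis by simp
    qed
    then have rows: "row i = row 0" if "i \<le> 2^n" for i
      using that by (induction i) auto
    have "row 0 = dyadic_sum n p"
      unfolding row_def H_def dyadic_sum_def
      by (intro sum.cong refl) (simp add: h(3) mesh del: of_nat_Suc)
    moreover have "row (2^n) = 0"
      unfolding row_def H_def
      by (intro sum.neutral) (simp add: h(4) mesh cocycle_self del: of_nat_Suc)
    ultimately show ?case using rows[of "2^n"] by simp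
  qed
qed

text \<open>Adding a value at \<open>inv g\<close> turns both values at \<open>g\<close> into values
  at \<open>\<one>\<close>, where the paths are loops and every value is \<open>0\<close>.\<close>

lemma path_value_unique:
  assumes "path_value g r" "path_value g s"
  shows "r = s"
proof -
  have one: "t = 0" if t: "path_value \<one> t" for t
  proof -
    obtain p where p: "path p" "path_image p \<subseteq> carrier G" "pathstart p = \<one>" "pathfinish p = \<one>"
      "\<forall>\<^sub>F n in sequentially. dyadic_sum n p = t"
      using t path_value_def by auto
    from eventually_conj[OF p(5) dyadic_sum_loop[OF p(1-4)]] show "t = 0"
      by (auto dest: eventually_happens)
  qed
  have g: "g \<in> carrier G"
    using assms(1) unfolding path_value_def by (metis pathfinish_in_path_image subsetD)
  then obtain t where t: "path_value (inv g) t"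
    using path_value_exists by blast
  have "r + t = 0" "s + t = 0"
    using one path_value_mult[OF assms(1) t] path_value_mult[OF assms(2) t] g by auto
  then show ?thesis by simp
qed

text \<open>Points within \<open>\<delta> / 2\<close> of \<open>p 0\<close> are within
  \<open>\<delta>\<close> of each other, so the cocycle identity collapses the sum from the left at
  every level \<open>n\<close>.\<close>

lemma dyadic_sum_small:
  assumes p: "path_image p \<subseteq> carrier G" and small: "\<And>t. t \<in> {0..1} \<Longrightarrow> dist (\<rho> (p 0)) (\<rho> (p t)) < \<delta> / 2"
  shows "dyadic_sum n p = c (p 0) (p 1)"
proof -
  have pG: "p t \<in> carrier G" if "t \<in> {0..1}" for t
    using p that by (auto simp: path_image_def)
  have "(\<Sum>i<k. c (p (real i / 2^n)) (p (real (Suc i) / 2^n))) = c (p 0) (p (real k / 2^n))"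
    if "k \<le> 2^n" for k
    using that
  proof (induction k)
    case 0
    then show ?case by (simp add: cocycle_self pG)
  next
    case (Suc k)
    then have k: "k < 2^n" by simp
    note m = dyadic_mesh[OF k]
    have "dist (\<rho> (p (real k / 2^n))) (\<rho> (p (real (Suc k) / 2^n))) < \<delta>"
      using small[OF m(1)] small[OF m(2)] dist_triangle_half_r by blast
    moreover have "dist (\<rho> (p 0)) (\<rho> (p (real k / 2^n))) < \<delta>"
      using small[OF m(1)] delta_pos by simp
    ultimately have "c (p 0) (p (real (Suc k) / 2^n))
        = c (p 0) (p (real k / 2^n)) + c (p (real k / 2^n)) (p (real (Suc k) / 2^n))"
      using m by (intro cocycle pG) auto
    then show ?case using Suc k by simp
  qed
  from this[of "2^n"] show ?thesis by (simp add: dyadic_sum_def)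
qed

text \<open>The homomorphism is the path value as a function of the endpoint. The second conclusion
  evaluates it near the unit, so that it can be shown not to vanish.\<close>

theorem integrate_cocycle:
  obtains \<phi> where "\<And>g h. \<lbrakk>g \<in> carrier G; h \<in> carrier G\<rbrakk> \<Longrightarrow> \<phi> (g \<otimes> h) = \<phi> g + \<phi> h"
    and "\<And>p. \<lbrakk>path p; path_image p \<subseteq> carrier G; pathstart p = \<one>;
              \<And>t. t \<in> {0..1} \<Longrightarrow> dist (\<rho> \<one>) (\<rho> (p t)) < \<delta> / 2\<rbrakk>
            \<Longrightarrow> \<phi> (pathfinish p) = c \<one> (pathfinish p)"
proof -
  define \<phi> where "\<phi> g = (THE r. path_value g r)" for g
  have phi: "\<phi> g = r" if "path_value g r" for g r
    unfolding \<phi>_def using that path_value_unique by blast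
  show ?thesis
  proof
    fix g h assume "g \<in> carrier G" "h \<in> carrier G"
    then obtain r s where "path_value g r" "path_value h s"
      using path_value_exists by metis
    then show "\<phi> (g \<otimes> h) = \<phi> g + \<phi> h"
      using phi path_value_mult by metis
  next
    fix p assume p: "path p" "path_image p \<subseteq> carrier G" "pathstart p = \<one>"
      "\<And>t. t \<in> {0..1} \<Longrightarrow> dist (\<rho> \<one>) (\<rho> (p t)) < \<delta> / 2"
    have "dyadic_sum n p = c \<one> (pathfinish p)" for n
      using dyadic_sum_small[OF p(2), of n] p(3,4) by (simp add: pathstart_def pathfinish_def)
    then have "path_value (pathfinish p) (c \<one> (pathfinish p))"
      unfolding path_value_def using p by (intro exI[of _ p]) simp
    then show "\<phi> (pathfinish p) = c \<one> (pathfinish p)" by (rule phi)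
  qed
qed

end

text \<open>The zero set of an additive function is a subgroup and, since addition of reals is
  commutative, contains every commutator.\<close>

lemma additive_zero_on_derived:
  fixes \<phi> :: "'g \<Rightarrow> real"
  assumes "group G" and add: "\<And>g h. \<lbrakk>g \<in> carrier G; h \<in> carrier G\<rbrakk> \<Longrightarrow> \<phi> (g \<otimes>\<^bsub>G\<^esub> h) = \<phi> g + \<phi> h"
    and "x \<in> derived G (carrier G)"
  shows "\<phi> x = 0"
proof -
  interpret group G by fact
  have one: "\<phi> \<one>\<^bsub>G\<^esub> = 0" using add[of "\<one>\<^bsub>G\<^esub>" "\<one>\<^bsub>G\<^esub>"] by simp
  have inv: "\<phi> (inv\<^bsub>G\<^esub> g) = - \<phi> g" if "g \<in> carrier G" for g
    using add[of g "inv\<^bsub>G\<^esub> g"] that one by simp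
  have "subgroup {g \<in> carrier G. \<phi> g = 0} G"
    by unfold_locales (auto simp: one inv add)
  moreover have "derived_set G (carrier G) \<subseteq> {g \<in> carrier G. \<phi> g = 0}"
    by (auto simp: add inv)
  ultimately show ?thesis
    using assms(3) generate_subgroup_incl unfolding derived_def by blast
qed

section \<open>The trace of the logarithm\<close>

lemma blinfun_compose_assoc: "(A o\<^sub>L B) o\<^sub>L C = A o\<^sub>L (B o\<^sub>L C)"
  by (rule blinfun_eqI) simp

lemma blinfun_compose_id [simp]: "id_blinfun o\<^sub>L A = A" "A o\<^sub>L id_blinfun = A"
  by (rule blinfun_eqI, simp)+

interpretation blinfun_compose: bounded_bilinear "(o\<^sub>L)"
  by (rule bounded_bilinear_blinfun_compose)

section \<open>Powers and Neumann series of bounded operators\<close>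

primrec blinfun_pow :: "('a::real_normed_vector \<Rightarrow>\<^sub>L 'a) \<Rightarrow> nat \<Rightarrow> ('a \<Rightarrow>\<^sub>L 'a)" where
  "blinfun_pow A 0 = id_blinfun"
| "blinfun_pow A (Suc n) = A o\<^sub>L blinfun_pow A n"

lemma blinfun_pow_add: "blinfun_pow A (m + n) = blinfun_pow A m o\<^sub>L blinfun_pow A n"
  by (induction m) (simp_all add: blinfun_compose_assoc)

lemma blinfun_pow_Suc_right: "blinfun_pow A (Suc n) = blinfun_pow A n o\<^sub>L A"
  using blinfun_pow_add[of A n 1] by simp

lemma norm_blinfun_pow: "norm (blinfun_pow A n) \<le> norm A ^ n"
proof (induction n)
  case 0
  then show ?case by (simp add: norm_blinfun_id_le)
next
  case (Suc n)
  have "norm (blinfun_pow A (Suc n)) \<le> norm A * norm (blinfun_pow A n)"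
    by (simp add: norm_blinfun_compose)
  also have "\<dots> \<le> norm A * norm A ^ n"
    using Suc by (intro mult_left_mono) auto
  finally show ?case by simp
qed

text \<open>For \<open>norm A < 1\<close> this is the inverse of \<open>id_blinfun - A\<close>. It
  arises from differentiating the logarithm series term by term.\<close>

definition neumann :: "('a::banach \<Rightarrow>\<^sub>L 'a) \<Rightarrow> ('a \<Rightarrow>\<^sub>L 'a)" where
  "neumann A = (\<Sum>n. blinfun_pow A n)"

lemma neumann_sums:
  assumes "norm A < 1"
  shows "blinfun_pow A sums neumann A"
  unfolding neumann_def
  by (intro summable_sums summable_comparison_test'[OF summable_geometric norm_blinfun_pow])
    (use assms in auto)

text \<open>Multiplication by \<open>id_blinfun - A\<close> on either side gives a telescoping
  series with sum \<open>id_blinfun\<close>, because the powers of \<open>A\<close> tend to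
  \<open>0\<close>.\<close>

lemma neumann_inverse:
  assumes "norm A < 1"
  shows "neumann A o\<^sub>L (id_blinfun - A) = id_blinfun" "(id_blinfun - A) o\<^sub>L neumann A = id_blinfun"
proof -
  have "blinfun_pow A \<longlonglongrightarrow> 0"
    using neumann_sums[OF assms] summable_LIMSEQ_zero sums_summable by blast
  from telescope_sums'[OF this]
  have tele: "(\<lambda>n. blinfun_pow A n - blinfun_pow A (Suc n)) sums id_blinfun" by simp
  have "(\<lambda>n. blinfun_pow A n o\<^sub>L (id_blinfun - A)) sums (neumann A o\<^sub>L (id_blinfun - A))"
    by (rule bounded_linear.sums[OF blinfun_compose.bounded_linear_left neumann_sums[OF assms]])
  moreover have "(\<lambda>n. blinfun_pow A n o\<^sub>L (id_blinfun - A)) = (\<lambda>n. blinfun_pow A n - blinfun_pow A (Suc n))"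
    by (simp add: blinfun_compose.diff_right blinfun_pow_Suc_right del: blinfun_pow.simps(2))
  ultimately show "neumann A o\<^sub>L (id_blinfun - A) = id_blinfun"
    using tele sums_unique2 by metis
  have "(\<lambda>n. (id_blinfun - A) o\<^sub>L blinfun_pow A n) sums ((id_blinfun - A) o\<^sub>L neumann A)"
    by (rule bounded_linear.sums[OF blinfun_compose.bounded_linear_right neumann_sums[OF assms]])
  moreover have "(\<lambda>n. (id_blinfun - A) o\<^sub>L blinfun_pow A n) = (\<lambda>n. blinfun_pow A n - blinfun_pow A (Suc n))"
    by (simp add: blinfun_compose.diff_left)
  ultimately show "(id_blinfun - A) o\<^sub>L neumann A = id_blinfun"
    using tele sums_unique2 by metis
qed

text \<open>The \<open>t\<close>-derivative of the \<open>n\<close>-th power of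
  \<open>a + t *\<^sub>R b\<close>. As \<open>a\<close> and \<open>b\<close> need not commute, the
  product rule is recorded recursively.\<close>

primrec line_pow_deriv ::
    "('a::real_normed_vector \<Rightarrow>\<^sub>L 'a) \<Rightarrow> ('a \<Rightarrow>\<^sub>L 'a) \<Rightarrow> real \<Rightarrow> nat \<Rightarrow> ('a \<Rightarrow>\<^sub>L 'a)" where
  "line_pow_deriv a b t 0 = 0"
| "line_pow_deriv a b t (Suc n) =
     (b o\<^sub>L blinfun_pow (a + t *\<^sub>R b) n) + ((a + t *\<^sub>R b) o\<^sub>L line_pow_deriv a b t n)"

lemma has_vector_derivative_blinfun_pow_line:
  "((\<lambda>t. blinfun_pow (a + t *\<^sub>R b) n) has_vector_derivative line_pow_deriv a b t n) (at t within S)"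
proof (induction n)
  case (Suc n)
  have "((\<lambda>t. a + t *\<^sub>R b) has_vector_derivative b) (at t within S)"
    by (auto intro!: derivative_eq_intros)
  from blinfun_compose.has_vector_derivative[OF this Suc] show ?case
    by (simp add: add.commute)
qed auto

text \<open>An abstract form of the imaginary part of the trace on a norm-closed unital algebra.
  \<open>T_bound\<close> supplies the continuity for passing to series and derivatives.\<close>

locale tracial_functional =
  fixes M :: "('a::banach \<Rightarrow>\<^sub>L 'a) set" and T :: "('a \<Rightarrow>\<^sub>L 'a) \<Rightarrow> real"
  assumes id_in: "id_blinfun \<in> M"
    and add_in: "\<lbrakk>A \<in> M; B \<in> M\<rbrakk> \<Longrightarrow> A + B \<in> M"
    and scaleR_in: "A \<in> M \<Longrightarrow> r *\<^sub>R A \<in> M"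
    and compose_in: "\<lbrakk>A \<in> M; B \<in> M\<rbrakk> \<Longrightarrow> A o\<^sub>L B \<in> M"
    and closed: "closed M"
    and T_add: "\<lbrakk>A \<in> M; B \<in> M\<rbrakk> \<Longrightarrow> T (A + B) = T A + T B"
    and T_scaleR: "A \<in> M \<Longrightarrow> T (r *\<^sub>R A) = r * T A"
    and T_bound: "A \<in> M \<Longrightarrow> \<bar>T A\<bar> \<le> norm A"
    and T_trace: "\<lbrakk>A \<in> M; B \<in> M\<rbrakk> \<Longrightarrow> T (A o\<^sub>L B) = T (B o\<^sub>L A)"
begin

section \<open>Closure of the algebra and continuity of the functional\<close>

lemma zero_in: "0 \<in> M" and T_zero: "T 0 = 0"
  using scaleR_in[OF id_in, of 0] T_scaleR[OF id_in, of 0] by auto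

lemma diff_in: "\<lbrakk>A \<in> M; B \<in> M\<rbrakk> \<Longrightarrow> A - B \<in> M"
  using add_in[of A "(-1) *\<^sub>R B"] scaleR_in[of B "-1"] by simp

lemma T_diff: "\<lbrakk>A \<in> M; B \<in> M\<rbrakk> \<Longrightarrow> T (A - B) = T A - T B"
  using T_add[of A "(-1) *\<^sub>R B"] scaleR_in[of B "-1"] T_scaleR[of B "-1"] by simp

lemma pow_in: "A \<in> M \<Longrightarrow> blinfun_pow A n \<in> M"
  by (induction n) (auto intro: id_in compose_in)

lemma line_in: "\<lbrakk>a \<in> M; b \<in> M\<rbrakk> \<Longrightarrow> a + t *\<^sub>R b \<in> M"
  by (intro add_in scaleR_in)

lemma line_pow_deriv_in: "\<lbrakk>a \<in> M; b \<in> M\<rbrakk> \<Longrightarrow> line_pow_deriv a b t n \<in> M"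
  by (induction n) (auto intro!: zero_in add_in compose_in pow_in scaleR_in)

lemma sum_in: "(\<And>i. i \<in> I \<Longrightarrow> f i \<in> M) \<Longrightarrow> sum f I \<in> M"
  by (induction I rule: infinite_finite_induct) (auto intro: zero_in add_in)

lemma T_sum: "(\<And>i. i \<in> I \<Longrightarrow> f i \<in> M) \<Longrightarrow> T (sum f I) = (\<Sum>i\<in>I. T (f i))"
  by (induction I rule: infinite_finite_induct) (auto simp: T_zero T_add sum_in)

lemma sums_in:
  assumes "\<And>n. f n \<in> M" "f sums s"
  shows "s \<in> M"
  using assms unfolding sums_def
  by (intro Lim_in_closed_set[OF closed _ trivial_limit_sequentially]) (auto intro!: sum_in always_eventually)

text \<open>\<open>T\<close> is linear on \<open>M\<close> only, so \<open>T_bound\<close> is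
  applied to the errors of the partial sums, which lie in \<open>M\<close> because \<open>M\<close>
  is closed.\<close>

lemma T_sums:
  assumes "\<And>n. f n \<in> M" "f sums s"
  shows "(\<lambda>n. T (f n)) sums T s"
proof -
  have "(\<lambda>n. norm (sum f {..<n} - s)) \<longlonglongrightarrow> 0"
    using assms(2) unfolding sums_def by (simp add: LIM_zero tendsto_norm_zero)
  moreover have "norm (T (sum f {..<n}) - T s) \<le> norm (sum f {..<n} - s)" for n
    using T_bound[of "sum f {..<n} - s"] assms(1) sums_in[OF assms] by (simp add: T_diff diff_in sum_in)
  ultimately have "(\<lambda>n. T (sum f {..<n}) - T s) \<longlonglongrightarrow> 0"
    by (intro Lim_null_comparison[of "\<lambda>n. T (sum f {..<n}) - T s" "\<lambda>n. norm (sum f {..<n} - s)"]) auto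
  then show ?thesis
    unfolding sums_def using assms(1) by (simp add: T_sum LIM_zero_iff)
qed

text \<open>\<open>T_bound\<close> lets the norm of the linear approximation error, an element of
  \<open>M\<close>, dominate the error after applying \<open>T\<close>.\<close>

lemma T_has_field_derivative:
  assumes g: "(g has_vector_derivative D) (at t within S)" and "\<And>s. g s \<in> M" "D \<in> M"
  shows "((\<lambda>s. T (g s)) has_field_derivative T D) (at t within S)"
proof -
  have "((\<lambda>s. norm (g s - g t - (s - t) *\<^sub>R D) / norm (s - t)) \<longlongrightarrow> 0) (at t within S)"
    using g unfolding has_vector_derivative_def has_derivative_iff_norm by blast
  moreover have "norm (T (g s) - T (g t) - T D * (s - t)) \<le> norm (g s - g t - (s - t) *\<^sub>R D)" for s
    using T_bound[of "g s - g t - (s - t) *\<^sub>R D"] assms(2,3)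
    by (simp add: T_diff T_scaleR diff_in scaleR_in mult.commute)
  ultimately have "((\<lambda>s. norm (T (g s) - T (g t) - T D * (s - t)) / norm (s - t)) \<longlongrightarrow> 0) (at t within S)"
    by (elim Lim_null_comparison[rotated])
      (auto intro!: always_eventually divide_right_mono)
  then show ?thesis
    unfolding has_field_derivative_def has_derivative_iff_norm
    by (simp add: bounded_linear_mult_right)
qed

text \<open>By traciality the \<open>n\<close> terms of the derivative of an \<open>n\<close>-th power have the same trace.\<close>

lemma T_line_pow_deriv:
  assumes "a \<in> M" "b \<in> M"
  shows "T (blinfun_pow (a + t *\<^sub>R b) k o\<^sub>L line_pow_deriv a b t (Suc n))
    = real (Suc n) * T (blinfun_pow (a + t *\<^sub>R b) (k + n) o\<^sub>L b)"
\<comment> \<open>The left factor is kept general because each application of the product rule moves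
  one factor \<open>a + t *\<^sub>R b\<close> into it.\<close>
proof (induction n arbitrary: k)
  case 0
  then show ?case by simp
next
  case (Suc n)
  let ?y = "a + t *\<^sub>R b"
  have P: "blinfun_pow ?y m \<in> M" for m by (rule pow_in[OF line_in[OF assms]])
  have "blinfun_pow ?y k o\<^sub>L line_pow_deriv a b t (Suc (Suc n))
      = ((blinfun_pow ?y k o\<^sub>L b) o\<^sub>L blinfun_pow ?y (Suc n))
        + (blinfun_pow ?y (Suc k) o\<^sub>L line_pow_deriv a b t (Suc n))"
    unfolding line_pow_deriv.simps(2)[of a b t "Suc n"] blinfun_pow_Suc_right[of ?y k]
    by (simp only: blinfun_compose.add_right[where b = "b o\<^sub>L _"] blinfun_compose_assoc)
  also have "T \<dots> = T ((blinfun_pow ?y k o\<^sub>L b) o\<^sub>L blinfun_pow ?y (Suc n))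
      + T (blinfun_pow ?y (Suc k) o\<^sub>L line_pow_deriv a b t (Suc n))"
    by (intro T_add compose_in P line_pow_deriv_in assms)
  also have "T ((blinfun_pow ?y k o\<^sub>L b) o\<^sub>L blinfun_pow ?y (Suc n))
      = T (blinfun_pow ?y (Suc n) o\<^sub>L (blinfun_pow ?y k o\<^sub>L b))"
    by (intro T_trace compose_in P assms)
  also have "blinfun_pow ?y (Suc n) o\<^sub>L (blinfun_pow ?y k o\<^sub>L b) = blinfun_pow ?y (k + Suc n) o\<^sub>L b"
    by (simp only: blinfun_compose_assoc[symmetric] blinfun_pow_add[symmetric] add.commute)
  also have "T (blinfun_pow ?y (Suc k) o\<^sub>L line_pow_deriv a b t (Suc n))
      = real (Suc n) * T (blinfun_pow ?y (Suc k + n) o\<^sub>L b)"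
    by (rule Suc)
  finally show ?case by (simp add: algebra_simps)
qed

text \<open>The Mercator series of \<open>T (log x)\<close>.\<close>

definition trace_log :: "('a \<Rightarrow>\<^sub>L 'a) \<Rightarrow> real" where
  "trace_log x = - (\<Sum>n. T (blinfun_pow (id_blinfun - x) (Suc n)) / real (Suc n))"

text \<open>The factor \<open>Suc n\<close> from the trace of the differentiated power cancels the
  denominator, leaving the Neumann series composed with \<open>b\<close>. The bound
  \<open>r ^ n * norm b\<close> gives uniform convergence, which permits term-by-term
  differentiation.\<close>

lemma trace_log_line_derivative:
  assumes ab: "a \<in> M" "b \<in> M" and r: "\<And>t. t \<in> {0..1} \<Longrightarrow> norm (a + t *\<^sub>R b) \<le> r" "r < 1"
    and t: "t \<in> {0..1}"
  shows "((\<lambda>t. trace_log (id_blinfun - (a + t *\<^sub>R b))) has_field_derivative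
      - T (neumann (a + t *\<^sub>R b) o\<^sub>L b)) (at t within {0..1})"
proof -
  let ?y = "\<lambda>t. a + t *\<^sub>R b"
  let ?f = "\<lambda>n t. T (blinfun_pow (?y t) (Suc n)) / real (Suc n)"
  let ?f' = "\<lambda>n t. T (blinfun_pow (?y t) n o\<^sub>L b)"
  have y: "?y t \<in> M" for t by (rule line_in[OF ab])
  have r0: "0 \<le> r" using order_trans[OF norm_ge_zero r(1)[of 0]] by simp
  have pow_le: "norm (blinfun_pow (?y t) n) \<le> r ^ n" if "t \<in> {0..1}" for t n
    using norm_blinfun_pow[of "?y t" n] power_mono[OF r(1)[OF that] norm_ge_zero, of n] by linarith
  have geo: "summable (\<lambda>n. r ^ n)" using r0 r(2) by simp
  have der: "(?f n has_field_derivative ?f' n t) (at t within {0..1})" for n t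
  proof -
    have "((\<lambda>t. T (blinfun_pow (?y t) (Suc n))) has_field_derivative T (line_pow_deriv a b t (Suc n)))
        (at t within {0..1})"
      by (intro T_has_field_derivative has_vector_derivative_blinfun_pow_line pow_in y line_pow_deriv_in ab)
    from DERIV_cdivide[OF this, of "real (Suc n)"] show ?thesis
      using T_line_pow_deriv[OF ab, of t 0 n] by simp
  qed
  have f'_sums: "(\<lambda>n. ?f' n t) sums T (neumann (?y t) o\<^sub>L b)" if "t \<in> {0..1}" for t
  proof (rule T_sums)
    show "blinfun_pow (?y t) n o\<^sub>L b \<in> M" for n by (intro compose_in pow_in y ab)
    show "(\<lambda>n. blinfun_pow (?y t) n o\<^sub>L b) sums (neumann (?y t) o\<^sub>L b)"
      using r(1)[OF that] r(2)
      by (intro bounded_linear.sums[OF blinfun_compose.bounded_linear_left] neumann_sums) simp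
  qed
  have "uniform_limit {0..1} (\<lambda>n t. \<Sum>i<n. ?f' i t) (\<lambda>t. \<Sum>i. ?f' i t) sequentially"
  proof (rule Weierstrass_m_test)
    show "norm (?f' n t) \<le> r ^ n * norm b" if "t \<in> {0..1}" for n t
    proof -
      have "norm (?f' n t) \<le> norm (blinfun_pow (?y t) n o\<^sub>L b)"
        using T_bound[OF compose_in[OF pow_in[OF y] ab(2)]] by simp
      also have "\<dots> \<le> norm (blinfun_pow (?y t) n) * norm b" by (rule norm_blinfun_compose)
      also have "\<dots> \<le> r ^ n * norm b" by (intro mult_right_mono pow_le that) auto
      finally show ?thesis .
    qed
    show "summable (\<lambda>n. r ^ n * norm b)" using geo by (rule summable_mult2)
  qed
  moreover have "summable (\<lambda>n. ?f n 0)"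
  proof (rule summable_comparison_test'[OF geo])
    fix n
    have "norm (?f n 0) \<le> norm (T (blinfun_pow (?y 0) (Suc n))) / 1"
      unfolding norm_divide by (intro divide_left_mono) auto
    also have "\<dots> \<le> norm (blinfun_pow (?y 0) (Suc n))"
      using T_bound[OF pow_in[OF y]] by (simp only: real_norm_def div_by_1)
    also have "\<dots> \<le> r ^ Suc n" by (rule pow_le) simp
    also have "\<dots> \<le> r ^ n" using r0 r(2) by (simp add: mult_left_le_one_le)
    finally show "norm (?f n 0) \<le> r ^ n" .
  qed
  ultimately have "\<exists>g. \<forall>t\<in>{0..1}. (\<lambda>n. ?f n t) sums g t
      \<and> (g has_field_derivative (\<Sum>i. ?f' i t)) (at t within {0..1})"
    by (intro has_field_derivative_series[of "{0..1}" ?f ?f' "\<lambda>t. \<Sum>i. ?f' i t" 0] der)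
      simp_all
  then obtain g where g: "\<And>t. t \<in> {0..1} \<Longrightarrow> (\<lambda>n. ?f n t) sums g t"
      "\<And>t. t \<in> {0..1} \<Longrightarrow> (g has_field_derivative (\<Sum>i. ?f' i t)) (at t within {0..1})"
    by blast
  have "((\<lambda>t. - g t) has_field_derivative - T (neumann (?y t) o\<^sub>L b)) (at t within {0..1})"
    using g(2)[OF t] f'_sums[OF t] by (intro DERIV_minus) (simp add: sums_iff)
  moreover have "trace_log (id_blinfun - ?y t) = - g t" if "t \<in> {0..1}" for t
    using g(1)[OF that] by (simp add: trace_log_def sums_iff add.commute del: blinfun_pow.simps)
  ultimately show ?thesis
    using has_field_derivative_transform_within[of "\<lambda>t. - g t" _ t "{0..1}" 1] t by auto
qed

text \<open>Along the segment from \<open>1\<close> to \<open>v\<close>, both \<open>T (log (u w))\<close> and \<open>T (log w)\<close> have derivative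
  \<open>T (w\<^sup>-\<^sup>1 w')\<close>.\<close>

theorem trace_log_mult:
  assumes uv: "u \<in> M" "v \<in> M" and small: "norm (id_blinfun - u) < 1/4" "norm (id_blinfun - v) < 1/4"
  shows "trace_log (u o\<^sub>L v) = trace_log u + trace_log v"
proof -
  let ?b = "id_blinfun - v" and ?a = "id_blinfun - u"
  define h where "h t = trace_log (id_blinfun - (?a + t *\<^sub>R (u o\<^sub>L ?b))) - trace_log (id_blinfun - (0 + t *\<^sub>R ?b))" for t
  have inM: "?b \<in> M" "?a \<in> M" "u o\<^sub>L ?b \<in> M" by (intro diff_in id_in compose_in uv)+
  \<comment> \<open>The common bound \<open>9/16\<close> is \<open>1/4 + 5/4 * 1/4\<close>, from
    \<open>norm u \<le> 5/4\<close>. Being below \<open>1\<close>, it keeps both logarithm series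
    convergent along the segments.\<close>
  have n2: "norm (0 + t *\<^sub>R ?b) \<le> 9/16" if "t \<in> {0..1}" for t
    using mult_mono[of "\<bar>t\<bar>" 1 "norm ?b" "1/4"] that small(2) by simp
  have n1: "norm (?a + t *\<^sub>R (u o\<^sub>L ?b)) \<le> 9/16" if "t \<in> {0..1}" for t
  proof -
    have "norm u \<le> 1 + 1/4"
      using norm_triangle_ineq4[of "id_blinfun" "?a"] small(1) norm_blinfun_id_le[where 'a='a] by simp
    then have "norm (u o\<^sub>L ?b) \<le> 5/4 * (1/4)"
      using norm_blinfun_compose[of u ?b] mult_mono[of "norm u" "5/4" "norm ?b" "1/4"] small(2) by simp
    then have "norm (t *\<^sub>R (u o\<^sub>L ?b)) \<le> 1 * (5/16)"
      unfolding norm_scaleR using that by (intro mult_mono) auto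
    then show ?thesis
      using norm_triangle_ineq[of ?a "t *\<^sub>R (u o\<^sub>L ?b)"] small(1) by linarith
  qed
  have "(h has_field_derivative 0) (at t within {0..1})" if t: "t \<in> {0..1}" for t
  proof -
    let ?w = "id_blinfun - t *\<^sub>R ?b"
    let ?R = "neumann (?a + t *\<^sub>R (u o\<^sub>L ?b))" and ?Q = "neumann (0 + t *\<^sub>R ?b)"
    have eq: "id_blinfun - (?a + t *\<^sub>R (u o\<^sub>L ?b)) = u o\<^sub>L ?w"
      by (simp add: blinfun_compose.diff_right blinfun_compose.scaleR_right)
    have Ruw: "?R o\<^sub>L (u o\<^sub>L ?w) = id_blinfun"
      using neumann_inverse(1)[of "?a + t *\<^sub>R (u o\<^sub>L ?b)"] n1[OF t] unfolding eq by simp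
    have wQ: "?w o\<^sub>L ?Q = id_blinfun"
      using neumann_inverse(2)[of "0 + t *\<^sub>R ?b"] n2[OF t] by simp
    \<comment> \<open>\<open>?R\<close> is a left inverse of \<open>u o\<^sub>L ?w\<close> and
      \<open>?Q\<close> a right inverse of \<open>?w\<close>, so associativity identifies
      \<open>?R o\<^sub>L u\<close> with \<open>?Q\<close>.\<close>
    have "?R o\<^sub>L u = (?R o\<^sub>L (u o\<^sub>L ?w)) o\<^sub>L ?Q"
      by (simp only: blinfun_compose_assoc wQ blinfun_compose_id)
    also have "\<dots> = ?Q"
      by (simp only: Ruw blinfun_compose_id)
    finally have "?R o\<^sub>L u = ?Q" .
    then have "(?R o\<^sub>L u) o\<^sub>L ?b = ?Q o\<^sub>L ?b" by simp
    then have "?R o\<^sub>L (u o\<^sub>L ?b) = ?Q o\<^sub>L ?b"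
      by (simp only: blinfun_compose_assoc)
    moreover have "(h has_field_derivative
        - T (?R o\<^sub>L (u o\<^sub>L ?b)) - - T (?Q o\<^sub>L ?b)) (at t within {0..1})"
      unfolding h_def
      by (intro DERIV_diff trace_log_line_derivative[OF inM(2,3) n1 _ t]
          trace_log_line_derivative[OF zero_in inM(1) n2 _ t]) auto
    ultimately show ?thesis by simp
  qed
  then obtain k where k: "\<And>t. t \<in> {0..1} \<Longrightarrow> h t = k"
    using has_field_derivative_zero_constant[of "{0..1}" h] by auto
  \<comment> \<open>At \<open>0\<close> the two arguments of \<open>trace_log\<close> are
    \<open>u\<close> and \<open>id_blinfun\<close>, at \<open>1\<close> they are
    \<open>u o\<^sub>L v\<close> and \<open>v\<close>.\<close>
  have "h 0 = h 1" using k[of 0] k[of 1] by simp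
  then have "trace_log u - trace_log id_blinfun = trace_log (u o\<^sub>L v) - trace_log v"
    by (simp add: h_def blinfun_compose.diff_right)
  moreover have "trace_log id_blinfun = 0"
    by (simp add: trace_log_def T_zero)
  ultimately show ?thesis by simp
qed

end

section \<open>Scalar operators and commutants\<close>

lemma scaleC_one [simp]: "scaleC 1 (x :: 'h::chilbert_space) = x"
  using scaleR_scaleC[of 1 x] by simp

lemma bounded_linear_scalar_op: "bounded_linear (scalar_op :: complex \<Rightarrow> ('h::chilbert_space \<Rightarrow>\<^sub>L 'h))"
proof (rule bounded_linear_intro[of _ 1])
  show "scalar_op (a + b) = (scalar_op a + scalar_op b :: 'h \<Rightarrow>\<^sub>L 'h)" for a b
    by (rule blinfun_eqI) (simp add: scaleC_add_left blinfun.add_left)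
  show "scalar_op (r *\<^sub>R a) = (r *\<^sub>R scalar_op a :: 'h \<Rightarrow>\<^sub>L 'h)" for r a
    by (rule blinfun_eqI) (simp add: blinfun.scaleR_left scaleR_scaleC scaleC_scaleC scaleR_conv_of_real)
  show "norm (scalar_op a :: 'h \<Rightarrow>\<^sub>L 'h) \<le> norm a * 1" for a
    by (rule norm_blinfun_bound) (auto simp: norm_scaleC)
qed

lemma scalar_op_one [simp]: "scalar_op 1 = id_blinfun"
  by (rule blinfun_eqI) simp

lemma scalar_op_compose: "scalar_op a o\<^sub>L scalar_op b = scalar_op (a * b)"
  by (rule blinfun_eqI) (simp add: scaleC_scaleC)

lemma blinfun_pow_scalar_op: "blinfun_pow (scalar_op a) n = scalar_op (a ^ n)"
  by (induction n) (simp_all add: scalar_op_compose)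

text \<open>Turns real scaling into composition with a scalar operator, for which the homogeneity of
  the trace is stated.\<close>

lemma scaleR_eq_scalar_op: "r *\<^sub>R A = scalar_op (complex_of_real r) o\<^sub>L A"
  by (rule blinfun_eqI) (simp add: blinfun.scaleR_left scaleR_scaleC)

lemma scalar_op_bounded_operators: "scalar_op a \<in> bounded_operators"
  by (simp add: bounded_operators_def scaleC_scaleC mult.commute)

lemma adj_scalar_op: "adj (scalar_op a) = scalar_op (cnj a)"
proof (intro blinfun_eqI cinner_eqI)
  fix x y
  show "Re (cinner x (blinfun_apply (adj (scalar_op a)) y)) = Re (cinner x (blinfun_apply (scalar_op (cnj a)) y))"
    unfolding cinner_adj[OF scalar_op_bounded_operators, symmetric]
    by (simp add: cinner_scaleC_left cinner_scaleC_right)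
qed

lemma abs_Re_cinner_le: "\<bar>Re (cinner x y)\<bar> \<le> norm x * norm y"
  using Re_cinner_le[of x y] Re_cinner_le[of "(-1) *\<^sub>R x" y] by (simp only: cinner_scaleR_left) simp

lemma abs_Im_cinner_le: "\<bar>Im (cinner x y)\<bar> \<le> norm x * norm y"
  using abs_Re_cinner_le[of "scaleC \<i> x" y] by (simp add: cinner_scaleC_left norm_scaleC)

text \<open>All defining conditions are equations between norm-continuous functions of
  \<open>A\<close>. Norm-closedness of \<open>M\<close> follows, as \<open>M\<close> is its own
  bicommutant.\<close>

lemma closed_commutant:
  fixes S :: "('h::chilbert_space \<Rightarrow>\<^sub>L 'h) set"
  shows "closed (commutant S)"
proof -
  have "closed {A :: 'h \<Rightarrow>\<^sub>L 'h. \<forall>c x. blinfun_apply A (scaleC c x) = scaleC c (blinfun_apply A x)}"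
    by (intro closed_Collect_all closed_Collect_eq bounded_linear.continuous_on[OF bounded_linear_scaleC]
        continuous_intros)
  moreover have "closed (\<Inter>B\<in>S. {A. A o\<^sub>L B = B o\<^sub>L A})"
    by (intro closed_INT ballI closed_Collect_eq continuous_intros)
  moreover have "commutant S = {A. \<forall>c x. blinfun_apply A (scaleC c x) = scaleC c (blinfun_apply A x)}
      \<inter> (\<Inter>B\<in>S. {A. A o\<^sub>L B = B o\<^sub>L A})"
    by (auto simp: commutant_def bounded_operators_def)
  ultimately show ?thesis by (simp only: closed_Int)
qed

lemma add_commutant: "\<lbrakk>A \<in> commutant S; B \<in> commutant S\<rbrakk> \<Longrightarrow> A + B \<in> commutant S"
  by (auto simp: commutant_def bounded_operators_def blinfun.add_left scaleC_add_right
      blinfun_compose.add_left blinfun_compose.add_right)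

lemma compose_commutant: "\<lbrakk>A \<in> commutant S; B \<in> commutant S\<rbrakk> \<Longrightarrow> A o\<^sub>L B \<in> commutant S"
  unfolding commutant_def
proof (safe)
  assume AB: "A \<in> bounded_operators" "B \<in> bounded_operators" "\<forall>C\<in>S. A o\<^sub>L C = C o\<^sub>L A" "\<forall>C\<in>S. B o\<^sub>L C = C o\<^sub>L B"
  show "A o\<^sub>L B \<in> bounded_operators" using AB by (simp add: bounded_operators_def)
  fix C assume "C \<in> S"
  then show "(A o\<^sub>L B) o\<^sub>L C = C o\<^sub>L (A o\<^sub>L B)"
    using AB(3,4) by (metis blinfun_compose_assoc)
qed

lemma scalar_op_commutant: "S \<subseteq> bounded_operators \<Longrightarrow> scalar_op a \<in> commutant S"
  by (auto simp: commutant_def scalar_op_bounded_operators bounded_operators_def scaleC_scaleC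
      mult.commute intro!: blinfun_eqI)

section \<open>The trace of a finite von Neumann algebra\<close>

context
  fixes M :: "('h::chilbert_space \<Rightarrow>\<^sub>L 'h) set"
  assumes M: "von_neumann_algebra M"
begin

section \<open>Closure properties of a von Neumann algebra\<close>

lemma vN_bicommutant: "M = commutant (commutant M)"
  using M by (simp add: von_neumann_algebra_def)

lemma vN_bounded: "A \<in> M \<Longrightarrow> A \<in> bounded_operators"
  using M by (auto simp: von_neumann_algebra_def)

lemma vN_adj: "A \<in> M \<Longrightarrow> adj A \<in> M"
  using M by (auto simp: von_neumann_algebra_def)

lemma vN_closed: "closed M"
  by (subst vN_bicommutant) (rule closed_commutant)

lemma vN_add: "\<lbrakk>A \<in> M; B \<in> M\<rbrakk> \<Longrightarrow> A + B \<in> M"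
  using add_commutant vN_bicommutant by metis

lemma vN_compose: "\<lbrakk>A \<in> M; B \<in> M\<rbrakk> \<Longrightarrow> A o\<^sub>L B \<in> M"
  using compose_commutant vN_bicommutant by metis

lemma vN_scalar_op: "scalar_op a \<in> M"
  by (subst vN_bicommutant) (rule scalar_op_commutant, auto simp: commutant_def)

lemma vN_id: "id_blinfun \<in> M"
  using vN_scalar_op[of 1] by simp

context
  fixes \<tau> assumes \<tau>: "tracial_state M \<tau>"
begin

section \<open>Reality, boundedness and scalar values of the trace\<close>

lemma trace_add: "\<lbrakk>A \<in> M; B \<in> M\<rbrakk> \<Longrightarrow> \<tau> (A + B) = \<tau> A + \<tau> B"
  and trace_scalar_compose: "A \<in> M \<Longrightarrow> \<tau> (scalar_op c o\<^sub>L A) = c * \<tau> A"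
  and trace_pos: "\<lbrakk>A \<in> M; positive_op A\<rbrakk> \<Longrightarrow> \<tau> A \<in> \<real>\<^sub>\<ge>\<^sub>0"
  and trace_id: "\<tau> id_blinfun = 1"
  and trace_commute: "\<lbrakk>A \<in> M; B \<in> M\<rbrakk> \<Longrightarrow> \<tau> (A o\<^sub>L B) = \<tau> (B o\<^sub>L A)"
  using \<tau> unfolding tracial_state_def by blast+

lemma trace_scalar_op: "\<tau> (scalar_op c) = c"
  using trace_scalar_compose[OF vN_id, of c] trace_id by simp

text \<open>The hypotheses make both \<open>k + C\<close> and \<open>k - C\<close> positive
  operators, so \<open>k\<close> plus or minus \<open>\<tau> C\<close> is a nonnegative
  real.\<close>

lemma trace_real_bound:
  assumes C: "C \<in> M" and real: "\<And>x. Im (cinner (C x) x) = 0"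
    and bound: "\<And>x. \<bar>Re (cinner (C x) x)\<bar> \<le> k * (norm x)\<^sup>2"
  shows "Im (\<tau> C) = 0" "\<bar>Re (\<tau> C)\<bar> \<le> k"
proof -
  have P: "complex_of_real k + complex_of_real s * \<tau> C \<in> \<real>\<^sub>\<ge>\<^sub>0" if "\<bar>s\<bar> = 1" for s :: real
  proof -
    let ?P = "scalar_op (complex_of_real k) + (scalar_op (complex_of_real s) o\<^sub>L C)"
    have inM: "?P \<in> M" using C by (intro vN_add vN_compose vN_scalar_op)
    have "cinner (?P x) x \<in> \<real>\<^sub>\<ge>\<^sub>0" for x
    proof -
      have "\<bar>s * Re (cinner (C x) x)\<bar> \<le> k * (norm x)\<^sup>2"
        using bound[of x] that by (simp add: abs_mult)
      then have "0 \<le> k * (norm x)\<^sup>2 + s * Re (cinner (C x) x)" by linarith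
      then show ?thesis
        using real[of x]
        by (simp add: blinfun.add_left cinner_add_left cinner_scaleC_left cinner_self complex_nonneg_Reals_iff)
    qed
    then have "positive_op ?P"
      unfolding positive_op_def using vN_bounded[OF inM] by blast
    from trace_pos[OF inM this] show ?thesis
      using C by (simp add: trace_add vN_compose vN_scalar_op trace_scalar_op trace_scalar_compose)
  qed
  from P[of 1] P[of "-1"] show "Im (\<tau> C) = 0" "\<bar>Re (\<tau> C)\<bar> \<le> k"
    by (auto simp: complex_nonneg_Reals_iff)
qed

text \<open>\<open>?B\<close> and \<open>?C\<close> are the real and imaginary parts of
  \<open>A\<close>, with real quadratic forms bounded through \<open>norm A\<close>. Hence
  \<open>\<tau> ?B\<close> is real and \<open>Im (\<tau> A) = Re (\<tau> ?C)\<close>.\<close>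

lemma abs_Im_trace_le:
  assumes A: "A \<in> M"
  shows "\<bar>Im (\<tau> A)\<bar> \<le> norm A"
proof -
  let ?B = "(scalar_op (1/2) o\<^sub>L A) + (scalar_op (1/2) o\<^sub>L adj A)"
  let ?C = "(scalar_op (- \<i>/2) o\<^sub>L A) + (scalar_op (\<i>/2) o\<^sub>L adj A)"
  have inM: "?B \<in> M" "?C \<in> M" using A vN_adj by (auto intro!: vN_add vN_compose vN_scalar_op)
  have adjA: "cinner (adj A x) x = cnj (cinner (A x) x)" for x
    using cinner_adj[OF vN_bounded[OF A], of x x] cinner_commute[of "adj A x" x] by simp
  have le: "norm (A x) * norm x \<le> norm A * (norm x)\<^sup>2" for x
    using mult_right_mono[OF norm_blinfun[of A x] norm_ge_zero[of x]] by (simp add: power2_eq_square)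
  have B: "cinner (?B x) x = complex_of_real (Re (cinner (A x) x))" for x
    by (simp add: blinfun.add_left cinner_add_left cinner_scaleC_left adjA complex_eq_iff)
  have C: "cinner (?C x) x = complex_of_real (Im (cinner (A x) x))" for x
    by (simp add: blinfun.add_left cinner_add_left cinner_scaleC_left adjA complex_eq_iff)
  have "Im (\<tau> ?B) = 0"
    using abs_Re_cinner_le[of "A _" _] le
    by (intro trace_real_bound(1)[OF inM(1), of "norm A"]) (simp_all only: B Re_complex_of_real Im_complex_of_real, blast intro: order_trans)
  moreover have "\<bar>Re (\<tau> ?C)\<bar> \<le> norm A"
    using abs_Im_cinner_le[of "A _" _] le
    by (intro trace_real_bound(2)[OF inM(2)]) (simp_all only: C Re_complex_of_real Im_complex_of_real, blast intro: order_trans)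
  ultimately show ?thesis
    using A vN_adj[OF A] by (simp add: trace_add vN_compose vN_scalar_op trace_scalar_compose)
qed

text \<open>The imaginary part is the relevant one: the logarithm of a unitary near the identity is
  skew-adjoint, so its trace is purely imaginary.\<close>

lemma tracial_functional_Im_trace: "tracial_functional M (\<lambda>A. Im (\<tau> A))"
proof
  fix A B :: "'h \<Rightarrow>\<^sub>L 'h" and r :: real
  assume A: "A \<in> M"
  show "r *\<^sub>R A \<in> M" "Im (\<tau> (r *\<^sub>R A)) = r * Im (\<tau> A)"
    unfolding scaleR_eq_scalar_op using A by (simp_all add: vN_compose vN_scalar_op trace_scalar_compose)
  show "\<bar>Im (\<tau> A)\<bar> \<le> norm A" by (rule abs_Im_trace_le[OF A])
  assume B: "B \<in> M"
  show "A + B \<in> M" "A o\<^sub>L B \<in> M" "Im (\<tau> (A + B)) = Im (\<tau> A) + Im (\<tau> B)"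
    "Im (\<tau> (A o\<^sub>L B)) = Im (\<tau> (B o\<^sub>L A))"
    using A B by (simp_all add: vN_add vN_compose trace_add trace_commute[of A B])
qed (rule vN_id vN_closed)+

interpretation tracial_functional M "\<lambda>A. Im (\<tau> A)"
  by (rule tracial_functional_Im_trace)

text \<open>On scalars the operator series reduces to the Mercator series of the principal
  logarithm.\<close>

lemma trace_log_scalar_op:
  assumes "cmod (z - 1) < 1"
  shows "trace_log (scalar_op z) = Im (ln z)"
proof -
  have eq: "id_blinfun - scalar_op z = (scalar_op (1 - z) :: 'h \<Rightarrow>\<^sub>L 'h)"
    using linear_diff[OF bounded_linear.linear[OF bounded_linear_scalar_op], of 1 z] by (metis scalar_op_one)
  have "(\<lambda>n. - ((1 - z)^n) / of_nat n) sums ln z"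
    using Ln_series'[of "z - 1"] assms by simp
  then have "(\<lambda>n. Im (- ((1 - z)^n) / of_nat n)) sums Im (ln z)"
    by (rule bounded_linear.sums[OF bounded_linear_Im])
  \<comment> \<open>The term of index \<open>0\<close> is a division by zero, hence
    \<open>0\<close>, so the index can be shifted without changing the sum.\<close>
  then have "(\<lambda>n. Im (- ((1 - z)^Suc n) / of_nat (Suc n))) sums Im (ln z)"
    by (intro iffD2[OF sums_Suc_iff[where f = "\<lambda>n. Im (- ((1 - z)^n) / of_nat n)"]]) (simp del: of_nat_Suc power_Suc)
  then have "(\<lambda>n. - Im ((1 - z)^Suc n / of_nat (Suc n))) sums Im (ln z)"
    by (simp only: minus_divide_left[symmetric] uminus_complex.sel)
  then have "(\<lambda>n. Im ((1 - z)^Suc n / of_nat (Suc n))) sums (- Im (ln z))"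
    using sums_minus by fastforce
  then show ?thesis
    unfolding trace_log_def eq blinfun_pow_scalar_op trace_scalar_op
    by (simp add: sums_iff Im_divide_of_nat del: power_Suc of_nat_Suc)
qed

end

end


section \<open>Unitary groups and their simply connected covers\<close>

lemma norm_unitary_le:
  assumes "u \<in> bounded_operators" "adj u o\<^sub>L u = id_blinfun"
  shows "norm u \<le> 1"
proof (rule norm_blinfun_bound)
  fix x
  have "cinner (u x) (u x) = cinner x ((adj u o\<^sub>L u) x)"
    using cinner_adj[OF assms(1), of x "u x"] by simp
  then have "(norm (u x))\<^sup>2 = (norm x)\<^sup>2"
    unfolding assms(2) cinner_self blinfun_apply_id_blinfun by (simp only: of_real_eq_iff)
  then show "norm (u x) \<le> 1 * norm x" by (simp add: power2_eq_iff_nonneg)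
qed simp

theorem corollary2:
  fixes M :: "('h::chilbert_space \<Rightarrow>\<^sub>L 'h) set"
    and G :: "('g::topological_space, 'b) monoid_scheme"
    and \<rho> :: "'g \<Rightarrow> ('h \<Rightarrow>\<^sub>L 'h)"
  assumes "II1_factor M"
    and "universal_covering_group G \<rho> (unitary_group M)"
  shows "\<not> perfect_group G"
proof
  assume perfect: "perfect_group G"
  let ?U = "unitary_group M"
  have M: "von_neumann_algebra M"
    using assms(1) by (simp add: II1_factor_def factor_def)
  obtain \<tau> where \<tau>: "tracial_state M \<tau>"
    using assms(1) by (auto simp: II1_factor_def)
  interpret T: tracial_functional M "\<lambda>A. Im (\<tau> A)"
    by (rule tracial_functional_Im_trace[OF M \<tau>])
  have cov: "topological_group G" "simply_connected (carrier G)" "group ?U"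
      "covering_space (carrier G) \<rho> (carrier ?U)" "\<rho> \<in> hom G ?U"
    using assms(2)
    by (auto simp: universal_covering_group_def covering_group_def topological_group_def)
  interpret G: group G using cov(1) by (simp add: topological_group_def)
  interpret U: group ?U by (rule cov(3))
  interpret \<rho>: group_hom G ?U \<rho> by unfold_locales (rule cov(5))
  have cont: "continuous_on (carrier G) \<rho>"
    using cov(4) by (rule covering_space_imp_continuous)
  have U_mult: "x \<otimes>\<^bsub>?U\<^esub> y = x o\<^sub>L y" and U_one: "\<one>\<^bsub>?U\<^esub> = id_blinfun" for x y
    by (simp_all add: unitary_group_def)
  have U_in: "u \<in> M" if "u \<in> carrier ?U" for u
    using that by (simp add: unitary_group_def)
  have U_norm: "norm u \<le> 1" if "u \<in> carrier ?U" for u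
    using that vN_bounded[OF M] by (intro norm_unitary_le) (auto simp: unitary_group_def)
  have U_cancel: "inv\<^bsub>?U\<^esub> a \<otimes>\<^bsub>?U\<^esub> (a \<otimes>\<^bsub>?U\<^esub> b) = b" "a \<otimes>\<^bsub>?U\<^esub> (inv\<^bsub>?U\<^esub> a \<otimes>\<^bsub>?U\<^esub> b) = b"
    if "a \<in> carrier ?U" "b \<in> carrier ?U" for a b
    using that by (simp_all flip: U.m_assoc)
  \<comment> \<open>Left translates cancel in the inverse of \<open>u\<close> times
    \<open>v\<close>, which makes \<open>L\<close> left-invariant. For nearby \<open>u\<close> and
    \<open>v\<close> the series converges.\<close>
  define L where "L u v = T.trace_log (inv\<^bsub>?U\<^esub> u \<otimes>\<^bsub>?U\<^esub> v)" for u v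
  \<comment> \<open>Multiplication by a unitary does not increase the norm, so the distance of
    \<open>u\<close> and \<open>v\<close> bounds that of the quotient from the identity. The radius
    \<open>1/4\<close> is the one in \<open>T.trace_log_mult\<close>.\<close>
  have near: "norm (id_blinfun - (inv\<^bsub>?U\<^esub> u \<otimes>\<^bsub>?U\<^esub> v)) < 1/4"
    if "u \<in> carrier ?U" "v \<in> carrier ?U" "dist u v < 1/4" for u v
  proof -
    have "inv\<^bsub>?U\<^esub> u o\<^sub>L u = id_blinfun"
      using U.l_inv[OF that(1)] by (simp add: U_mult U_one)
    then have "id_blinfun - (inv\<^bsub>?U\<^esub> u \<otimes>\<^bsub>?U\<^esub> v) = inv\<^bsub>?U\<^esub> u o\<^sub>L (u - v)"
      by (simp add: U_mult blinfun_compose.diff_right)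
    also have "norm \<dots> \<le> norm (inv\<^bsub>?U\<^esub> u) * norm (u - v)"
      by (rule norm_blinfun_compose)
    also have "\<dots> \<le> 1 * norm (u - v)"
      using U_norm that(1) by (intro mult_right_mono) auto
    finally show ?thesis using that(3) by (simp add: dist_norm)
  qed
  interpret group_cocycle G \<rho> "\<lambda>x y. L (\<rho> x) (\<rho> y)" "1/4"
  proof
    fix x y z assume *: "x \<in> carrier G" "y \<in> carrier G" "z \<in> carrier G"
      "dist (\<rho> x) (\<rho> y) < 1/4" "dist (\<rho> y) (\<rho> z) < 1/4"
    have "inv\<^bsub>?U\<^esub> (\<rho> x) \<otimes>\<^bsub>?U\<^esub> \<rho> z
        = (inv\<^bsub>?U\<^esub> (\<rho> x) \<otimes>\<^bsub>?U\<^esub> \<rho> y) o\<^sub>L (inv\<^bsub>?U\<^esub> (\<rho> y) \<otimes>\<^bsub>?U\<^esub> \<rho> z)"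
      using *(1-3) by (simp flip: U_mult add: U.m_assoc U_cancel)
    then show "L (\<rho> x) (\<rho> z) = L (\<rho> x) (\<rho> y) + L (\<rho> y) (\<rho> z)"
      by (simp only: L_def) (intro T.trace_log_mult U_in near U.m_closed U.inv_closed \<rho>.hom_closed *)
  next
    fix g x y assume *: "g \<in> carrier G" "x \<in> carrier G" "y \<in> carrier G"
    then show "L (\<rho> (g \<otimes>\<^bsub>G\<^esub> x)) (\<rho> (g \<otimes>\<^bsub>G\<^esub> y)) = L (\<rho> x) (\<rho> y)"
      by (simp add: L_def U.inv_mult_group U.m_assoc U_cancel)
  qed (use cov cont in auto)
  obtain \<phi> where \<phi>_add: "\<And>g h. \<lbrakk>g \<in> carrier G; h \<in> carrier G\<rbrakk> \<Longrightarrow> \<phi> (g \<otimes>\<^bsub>G\<^esub> h) = \<phi> g + \<phi> h"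
    and \<phi>: "\<And>p. \<lbrakk>path p; path_image p \<subseteq> carrier G; pathstart p = \<one>\<^bsub>G\<^esub>;
              \<And>t. t \<in> {0..1} \<Longrightarrow> dist (\<rho> \<one>\<^bsub>G\<^esub>) (\<rho> (p t)) < 1/4/2\<rbrakk>
            \<Longrightarrow> \<phi> (pathfinish p) = L (\<rho> \<one>\<^bsub>G\<^esub>) (\<rho> (pathfinish p))"
    by (rule integrate_cocycle) blast
  \<comment> \<open>Perfectness puts every element of the cover in the derived subgroup, on which
    additive functions vanish.\<close>
  have \<phi>_zero: "\<phi> g = 0" if "g \<in> carrier G" for g
  proof (rule additive_zero_on_derived[OF G.group_axioms \<phi>_add])
    show "g \<in> derived G (carrier G)" using perfect that by (simp add: perfect_group_def)
  qed

  \<comment> \<open>A short arc of scalar unitaries and its lift\<close>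
  have \<rho>_one: "\<rho> \<one>\<^bsub>G\<^esub> = id_blinfun" using \<rho>.hom_one by (simp add: U_one)
  define e where "e t = (scalar_op (cis t) :: 'h \<Rightarrow>\<^sub>L 'h)" for t
  have eU: "e t \<in> carrier ?U" for t
    by (simp add: e_def unitary_group_def vN_scalar_op[OF M] adj_scalar_op scalar_op_compose cis_cnj cis_mult)
  have e0: "e 0 = id_blinfun" by (simp add: e_def)
  have e_cont: "continuous_on S e" for S
    unfolding e_def by (intro bounded_linear.continuous_on[OF bounded_linear_scalar_op] continuous_intros)
  have "id_blinfun \<in> carrier ?U" using eU[of 0] e0 by simp
  \<comment> \<open>Over an evenly covered neighbourhood \<open>V\<close> of the identity, the sheet
    \<open>W\<close> through the unit has a continuous inverse \<open>q\<close> of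
    \<open>\<rho>\<close>, which lifts short arcs.\<close>
  then obtain V \<W> where V: "id_blinfun \<in> V" "openin (top_of_set (carrier ?U)) V"
      "\<Union>\<W> = carrier G \<inter> \<rho> -` V" "\<And>W. W \<in> \<W> \<Longrightarrow> \<exists>q. homeomorphism W V \<rho> q"
    using cov(4) unfolding covering_space_def by metis
  have "\<one>\<^bsub>G\<^esub> \<in> \<Union>\<W>" using V(1,3) \<rho>_one by simp
  then obtain W where "W \<in> \<W>" "\<one>\<^bsub>G\<^esub> \<in> W" by (rule UnionE)
  moreover obtain q where "homeomorphism W V \<rho> q" using V(4)[OF \<open>W \<in> \<W>\<close>] by (rule exE)
  ultimately have W: "\<one>\<^bsub>G\<^esub> \<in> W" "W \<subseteq> carrier G" "homeomorphism W V \<rho> q"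
    using V(3) by auto
  obtain d where d: "d > 0" "\<And>u. \<lbrakk>u \<in> carrier ?U; dist u id_blinfun < d\<rbrakk> \<Longrightarrow> u \<in> V"
    using V(1,2) unfolding openin_euclidean_subtopology_iff by metis
  have "isCont e 0" using e_cont[of UNIV] by (simp add: continuous_on_eq_continuous_at)
  \<comment> \<open>\<open>d\<close> keeps the arc inside \<open>V\<close>; \<open>1/8\<close> is
    half the cocycle radius \<open>1/4\<close>.\<close>
  then obtain r where r: "r > 0" "\<And>t. \<bar>t\<bar> < r \<Longrightarrow> dist (e t) id_blinfun < min d (1/8)"
    using continuous_at_eps_delta[of 0 e, THEN iffD1, rule_format, of "min d (1/8)"] d(1) e0
    by (auto simp: dist_real_def)
  have "continuous_on UNIV cis" by (intro continuous_intros)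
  then have "isCont cis 0" by (simp add: continuous_on_eq_continuous_at)
  \<comment> \<open>This bound ensures convergence of the logarithm series at
    \<open>cis t\<close>.\<close>
  then obtain r' where r': "r' > 0" "\<And>t. \<bar>t\<bar> < r' \<Longrightarrow> cmod (cis t - 1) < 1"
    using continuous_at_eps_delta[of 0 cis, THEN iffD1, rule_format, of 1] by (auto simp: dist_norm)
  \<comment> \<open>Halving makes \<open>s\<close> strictly smaller than \<open>r\<close>,
    \<open>r'\<close> and \<open>1\<close>; the last also places it below \<open>pi\<close>.\<close>
  define s where "s = min (min r r') 1 / 2"
  have s: "0 < s" "s < r" "s < r'" "s < 1" using r(1) r'(1) by (auto simp: s_def)
  have eV: "e (s * t) \<in> V" "dist id_blinfun (e (s * t)) < 1/8" if "t \<in> {0..1}" for t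
  proof -
    have "\<bar>s * t\<bar> \<le> s * 1" using that s(1) by (simp add: abs_mult)
    then show "e (s * t) \<in> V" "dist id_blinfun (e (s * t)) < 1/8"
      using r(2)[of "s * t"] s(2) d(2)[OF eU] by (auto simp: dist_commute)
  qed
  define p where "p t = q (e (s * t))" for t
  have \<rho>p: "\<rho> (p t) = e (s * t)" and pW: "p t \<in> W" if "t \<in> {0..1}" for t
    using W(3) eV(1)[OF that] by (auto simp: p_def homeomorphism_def)
  have p_start: "p 0 = \<one>\<^bsub>G\<^esub>"
    using homeomorphism_apply1[OF W(3,1)] by (simp only: p_def e0 \<rho>_one mult_zero_right)
  have "path p"
    unfolding path_def p_def
  proof (rule continuous_on_compose2[of V q])
    show "continuous_on V q" using W(3) by (simp add: homeomorphism_def)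
    show "continuous_on {0..1} (\<lambda>t. e (s * t))"
      by (rule continuous_on_compose2[OF e_cont[of UNIV]]) (auto intro!: continuous_intros)
  qed (use eV in auto)
  moreover have "path_image p \<subseteq> carrier G" using pW W(2) by (auto simp: path_image_def)
  moreover have "dist (\<rho> \<one>\<^bsub>G\<^esub>) (\<rho> (p t)) < 1/4/2" if "t \<in> {0..1}" for t
    using eV(2)[OF that] \<rho>p[OF that] by (simp only: \<rho>_one)
  ultimately have "\<phi> (p 1) = L id_blinfun (e s)"
    using \<phi>[of p] p_start \<rho>p[of 1] by (simp only: pathstart_def pathfinish_def \<rho>_one) simp
  also have "\<dots> = T.trace_log (e s)"
    by (simp only: L_def U_one[symmetric] U.inv_one U.l_one eU)
  also have "\<dots> = Im (ln (cis s))"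
    unfolding e_def using r'(2)[of s] s by (intro trace_log_scalar_op[OF M \<tau>]) auto
  \<comment> \<open>Since \<open>0 < s < pi\<close>, the principal logarithm of \<open>cis s\<close>
    is \<open>\<i>\<close> times \<open>s\<close>.\<close>
  also have "\<dots> = s"
    using s pi_gt3 by (simp add: cis_conv_exp)
  \<comment> \<open>The endpoint of the lifted arc has \<open>\<phi>\<close>-value
    \<open>s > 0\<close>, although \<open>\<phi>\<close> vanishes on the whole group.\<close>
  finally show False
    using \<phi>_zero[of "p 1"] pW[of 1] W(2) s(1) by auto
qed

end
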